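(* For any graph $G$, there is a nested set $\mathcal{N}$ of separations of $G$ of finite order that contains, for any two distinct vertex-ends of $G$, a separation distinguishing them efficiently.
   Context: Graphs may be infinite. A vertex-end of $G$ is an equivalence class of rays (one-way infinite paths), where two rays are equivalent if they cannot be separated in $G$ by removing finitely many vertices. A separation of $G$ is an ordered pair $(A,B)$ of vertex sets with $A\cup B=V(G)$ such that no edge has one endvertex in $A\setminus B$ and the other in $B\setminus A$. Its separator is $A\cap B$, its order is $|A\cap B|$, and its reverse is $(B,A)$. We write $(A,B)\le(C,D)$ if $A\subseteq C$ and $D\subseteq B$. Two separations $(A,B)$, $(C,D)$ are nested if $(A,B)\le(C,D)$, $(B,A)\le(C,D)$, $(A,B)\le(D,C)$ or $(B,A)\le(D,C)$. A nested set is a set of pairwise nested separations. A vertex-end $\omega$ lives in a side $B$ of a separation $(A,B)$ of finite order if $B$ includes a ray belonging to $\omega$. A separation $(A,B)$ of finite order distinguishes two vertex-ends if one of them lives in $A$ and the other lives in $B$; it distinguishes them efficiently if it has minimal order amongst all separations distinguishing them. *)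

theory Defs
  imports Main
begin

text \<open>A graph is given by its vertex set \<open>V\<close>, of any cardinality, and its edge set \<open>E\<close>.\<close>

definition simple_graph :: "'a set \<Rightarrow> 'a set set \<Rightarrow> bool" where
  "simple_graph V E \<longleftrightarrow> (\<forall>e\<in>E. \<exists>u\<in>V. \<exists>v\<in>V. u \<noteq> v \<and> e = {u, v})"

text \<open>A ray is identified with the enumeration of its vertices along the ray, starting at
  its unique vertex of degree one; enumeration and subgraph determine each other.\<close>

definition rays :: "'a set \<Rightarrow> 'a set set \<Rightarrow> (nat \<Rightarrow> 'a) set" where
  "rays V E = {r. inj r \<and> range r \<subseteq> V \<and> (\<forall>i. {r i, r (Suc i)} \<in> E)}"

text \<open>\<open>linked V E S u v\<close>: the vertices \<open>u\<close> and \<open>v\<close> lie in the same component of \<open>G - S\<close>.\<close>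

definition linked :: "'a set \<Rightarrow> 'a set set \<Rightarrow> 'a set \<Rightarrow> 'a \<Rightarrow> 'a \<Rightarrow> bool" where
  "linked V E S u v \<longleftrightarrow> u \<in> V - S \<and> v \<in> V - S \<and>
     (u, v) \<in> {(x, y). x \<in> V - S \<and> y \<in> V - S \<and> {x, y} \<in> E}\<^sup>*"

text \<open>A set \<open>S\<close> may meet both vertex sets it separates. In particular a finite \<open>S\<close> may contain
  initial segments of the rays it separates, so that two rays can be separated by a finite set
  iff some finite set leaves them with tails in different components.\<close>

definition separates :: "'a set \<Rightarrow> 'a set set \<Rightarrow> 'a set \<Rightarrow> 'a set \<Rightarrow> 'a set \<Rightarrow> bool" where
  "separates V E S X Y \<longleftrightarrow> \<not> (\<exists>x\<in>X. \<exists>y\<in>Y. linked V E S x y)"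

definition ray_equiv :: "'a set \<Rightarrow> 'a set set \<Rightarrow> ((nat \<Rightarrow> 'a) \<times> (nat \<Rightarrow> 'a)) set" where
  "ray_equiv V E = {(r, r'). r \<in> rays V E \<and> r' \<in> rays V E \<and>
     \<not> (\<exists>S. S \<subseteq> V \<and> finite S \<and> separates V E S (range r) (range r'))}"

definition vertex_ends :: "'a set \<Rightarrow> 'a set set \<Rightarrow> (nat \<Rightarrow> 'a) set set" where
  "vertex_ends V E = rays V E // ray_equiv V E"

type_synonym 'a sep = "'a set \<times> 'a set"

definition separation :: "'a set \<Rightarrow> 'a set set \<Rightarrow> 'a sep \<Rightarrow> bool" where
  "separation V E = (\<lambda>(A, B). A \<union> B = V \<and> \<not> (\<exists>a\<in>A - B. \<exists>b\<in>B - A. {a, b} \<in> E))"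

definition separator :: "'a sep \<Rightarrow> 'a set" where
  "separator = (\<lambda>(A, B). A \<inter> B)"

text \<open>The order is used only for separations with finite separator, where \<open>card\<close> is the
  true cardinality.\<close>

definition sep_order :: "'a sep \<Rightarrow> nat" where
  "sep_order s = card (separator s)"

definition finite_order_separation :: "'a set \<Rightarrow> 'a set set \<Rightarrow> 'a sep \<Rightarrow> bool" where
  "finite_order_separation V E s \<longleftrightarrow> separation V E s \<and> finite (separator s)"

definition sep_reverse :: "'a sep \<Rightarrow> 'a sep" where
  "sep_reverse = (\<lambda>(A, B). (B, A))"

definition sep_le :: "'a sep \<Rightarrow> 'a sep \<Rightarrow> bool" where
  "sep_le = (\<lambda>(A, B) (C, D). A \<subseteq> C \<and> D \<subseteq> B)"

definition nested :: "'a sep \<Rightarrow> 'a sep \<Rightarrow> bool" where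
  "nested s t \<longleftrightarrow> sep_le s t \<or> sep_le (sep_reverse s) t \<or>
     sep_le s (sep_reverse t) \<or> sep_le (sep_reverse s) (sep_reverse t)"

definition nested_set :: "'a sep set \<Rightarrow> bool" where
  "nested_set N \<longleftrightarrow> (\<forall>s\<in>N. \<forall>t\<in>N. nested s t)"

definition lives_in :: "(nat \<Rightarrow> 'a) set \<Rightarrow> 'a set \<Rightarrow> bool" where
  "lives_in \<omega> X \<longleftrightarrow> (\<exists>r\<in>\<omega>. range r \<subseteq> X)"

definition distinguishes ::
  "'a set \<Rightarrow> 'a set set \<Rightarrow> 'a sep \<Rightarrow> (nat \<Rightarrow> 'a) set \<Rightarrow> (nat \<Rightarrow> 'a) set \<Rightarrow> bool" where
  "distinguishes V E s \<omega> \<omega>' \<longleftrightarrow> finite_order_separation V E s \<and>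
     (lives_in \<omega> (fst s) \<and> lives_in \<omega>' (snd s) \<or> lives_in \<omega>' (fst s) \<and> lives_in \<omega> (snd s))"

definition distinguishes_efficiently ::
  "'a set \<Rightarrow> 'a set set \<Rightarrow> 'a sep \<Rightarrow> (nat \<Rightarrow> 'a) set \<Rightarrow> (nat \<Rightarrow> 'a) set \<Rightarrow> bool" where
  "distinguishes_efficiently V E s \<omega> \<omega>' \<longleftrightarrow> distinguishes V E s \<omega> \<omega>' \<and>
     (\<forall>t. distinguishes V E t \<omega> \<omega>' \<longrightarrow> sep_order s \<le> sep_order t)"

end

theory Submission
  imports Defs Complex_Main
begin

text \<open>
  Ends are handled through rays representing them: two rays belong to different ends iff some
  separation of finite order has a tail of one in its first side and a tail of the other in its
  second side (\<open>ray_equiv_iff\<close>). The proof has two parts.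

  The first part finds a nested set \<open>M\<close> of \<^emph>\<open>separators\<close> (\<open>nested_separators\<close>), where finite sets \<open>X\<close>
  and \<open>Y\<close> are nested if \<open>Y\<close> does not separate two vertices of \<open>X\<close>. If a separation distinguishes two
  ends efficiently, then every vertex of its separator has neighbours in the components
  of both ends (\<open>eff_full\<close>); call such components full. This makes nestedness symmetric, and it
  makes every separator cross only finitely many others of a given order (\<open>finite_crossing\<close>),
  because a separator that crosses \<open>X\<close> is a minimal separator of two vertices of \<open>X\<close>. The set \<open>M\<close> is built by
  recursion on the order \<open>k\<close>: for each pair of ends, among its efficient separators of order \<open>k\<close> that
  are nested with everything chosen before, take those that cross as few efficient separators of
  order \<open>k\<close> as possible. Such separators exist because a crossing with a separator of
  smaller order can be removed by passing to a corner (\<open>uncross_lower\<close>), and two of them cannot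
  cross because opposite corners have together fewer crossings than the two separators
  (\<open>crossing_corners\<close>, \<open>uncross_equal\<close>). Both arguments use that anything nested with two crossing
  separators is nested with every separator inside their union (\<open>snest_union\<close>).

  The second part turns separators into separations. For \<open>X\<close> in \<open>M\<close> and a full component \<open>C\<close> of
  \<open>G - X\<close> the obvious separation has \<open>C\<close> on one side and all other components on the other. Two such
  separations may cross although their separators are nested. There are two reasons: the full
  components may point towards each other, or components that are not full lie on the wrong side.
  The first is avoided by fixing, in every class of ends not distinguished by order less than \<open>k\<close>,
  one representative, and by using only components \<open>C\<close> that avoid the representative.
  The second is avoided by recursion on \<open>k\<close>: the component \<open>C\<close> is enlarged by the small
  sides, meaning those away from the class, of the separations of smaller order that it meets.
  The enlarged separations are nested with those of smaller order (\<open>big_sep_oriented\<close>); hence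
  they are nested with each other if they belong to different classes
  (\<open>big_sep_nested_different\<close>), and within one class this follows from the choice of the
  representative (\<open>big_sep_nested_same\<close>).
\<close>

section \<open>Connectivity after deleting a vertex set\<close>

locale graph =
  fixes V :: "'a set" and E :: "'a set set"
  assumes simple: "simple_graph V E"
begin

text \<open>\<open>lk S u v\<close>: the vertices \<open>u\<close> and \<open>v\<close> lie in the same component of \<open>G - S\<close>.\<close>

abbreviation lk :: "'a set \<Rightarrow> 'a \<Rightarrow> 'a \<Rightarrow> bool" where
  "lk \<equiv> linked V E"

lemma edge_in_V: "{x, y} \<in> E \<Longrightarrow> x \<in> V \<and> y \<in> V"
  using simple unfolding simple_graph_def by (metis doubleton_eq_iff)

lemma edge_sym: "{x, y} \<in> E \<Longrightarrow> {y, x} \<in> E"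
  by (simp add: insert_commute)

lemma lk_in: "lk S u v \<Longrightarrow> u \<in> V \<and> u \<notin> S \<and> v \<in> V \<and> v \<notin> S"
  by (auto simp: linked_def)

lemma lk_refl: "u \<in> V \<Longrightarrow> u \<notin> S \<Longrightarrow> lk S u u"
  by (auto simp: linked_def)

lemma lk_trans: "lk S u v \<Longrightarrow> lk S v w \<Longrightarrow> lk S u w"
  by (auto simp: linked_def)

lemma lk_step:
  assumes "lk S u v" "{v, w} \<in> E" "w \<notin> S" shows "lk S u w"
proof -
  have "(v, w) \<in> {(x, y). x \<in> V - S \<and> y \<in> V - S \<and> {x, y} \<in> E}"
    using assms edge_in_V[of v w] by (simp add: linked_def)
  from rtrancl_into_rtrancl[OF _ this, of u] show ?thesis
    using assms(1,3) edge_in_V[OF assms(2)] by (auto simp: linked_def)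
qed

lemma lk_edge: "{v, w} \<in> E \<Longrightarrow> v \<notin> S \<Longrightarrow> w \<notin> S \<Longrightarrow> lk S v w"
  using lk_step lk_refl edge_in_V by blast

lemma lk_induct [consumes 1, case_names refl step]:
  assumes "lk S u v" "P u"
    and "\<And>x y. lk S u x \<Longrightarrow> P x \<Longrightarrow> {x, y} \<in> E \<Longrightarrow> y \<notin> S \<Longrightarrow> P y"
  shows "P v"
proof -
  have uv: "(u, v) \<in> {(x, y). x \<in> V - S \<and> y \<in> V - S \<and> {x, y} \<in> E}\<^sup>*"
    and u: "u \<in> V - S"
    using assms(1) by (auto simp: linked_def)
  from uv have "lk S u v \<and> P v"
  proof (induction rule: rtrancl_induct)
    case base
    then show ?case using u assms(2) lk_refl by auto
  next
    case (step y z)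
    then show ?case using assms(3) lk_step by blast
  qed
  then show ?thesis by simp
qed

lemma lk_sym:
  assumes "lk S u v" shows "lk S v u"
  using assms
proof (induction rule: lk_induct)
  case refl
  then show ?case using lk_in[OF assms] lk_refl by blast
next
  case (step x y)
  have "lk S y x"
    using step.hyps lk_in[OF step.hyps(1)] lk_edge[of y x S] edge_sym by blast
  then show ?case using step.IH by (rule lk_trans)
qed

lemma lk_mono:
  assumes "lk S u v" "T \<subseteq> S" shows "lk T u v"
  using assms(1)
proof (induction rule: lk_induct)
  case refl
  then show ?case using lk_in[OF assms(1)] assms(2) by (auto intro: lk_refl)
next
  case (step x y)
  then show ?case using assms(2) by (blast intro: lk_step)
qed

lemma lk_avoid:
  assumes "lk S u v" "\<And>w. lk S u w \<Longrightarrow> w \<notin> T" shows "lk T u v"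
  using assms(1)
proof (induction rule: lk_induct)
  case refl
  then show ?case using lk_in[OF assms(1)] assms(2)[of u] lk_refl by blast
next
  case (step x y)
  then show ?case using assms(2) lk_step by blast
qed

lemma lk_closed:
  assumes "lk S u v" "u \<in> U" "\<And>x y. x \<in> U \<Longrightarrow> {x, y} \<in> E \<Longrightarrow> y \<notin> S \<Longrightarrow> y \<in> U"
  shows "v \<in> U"
  using assms(1)
proof (induction rule: lk_induct)
  case refl
  then show ?case using assms(2) .
next
  case (step x y)
  then show ?case using assms(3) by blast
qed

lemma separation_edge:
  assumes "separation V E (A, B)" "{x, y} \<in> E" "x \<in> A" "x \<notin> B"
  shows "y \<in> A"
  using assms edge_in_V[of x y] unfolding separation_def by auto

lemma separation_swap:
  assumes "separation V E (A, B)" shows "separation V E (B, A)"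
proof -
  have "{b, a} \<notin> E" if "a \<in> A - B" "b \<in> B - A" for a b
    using assms that edge_sym[of b a] by (auto simp: separation_def)
  moreover have "B \<union> A = V" using assms by (auto simp: separation_def)
  ultimately show ?thesis by (auto simp: separation_def)
qed

lemma lk_separation:
  assumes "separation V E (A, B)" "lk (A \<inter> B) u v" "u \<in> A"
  shows "v \<in> A - B"
proof (rule lk_closed[OF assms(2)])
  show "u \<in> A - B" using assms lk_in by blast
next
  fix x y assume "x \<in> A - B" "{x, y} \<in> E" "y \<notin> A \<inter> B"
  then show "y \<in> A - B" using separation_edge[OF assms(1)] by blast
qed

section \<open>Full components and nested separators\<close>

text \<open>A component \<open>C\<close> of \<open>G - X\<close> is \<^emph>\<open>full\<close> if every vertex of \<open>X\<close> has a neighbour in it.\<close>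

definition full :: "'a set \<Rightarrow> 'a set \<Rightarrow> bool" where
  "full X C \<longleftrightarrow> (\<exists>u\<in>C. C = {w. lk X u w}) \<and> (\<forall>x\<in>X. \<exists>c\<in>C. {x, c} \<in> E)"

text \<open>Nestedness of vertex sets: \<open>Y\<close> does not separate any two vertices of \<open>X\<close>.\<close>

definition snest :: "'a set \<Rightarrow> 'a set \<Rightarrow> bool" where
  "snest X Y \<longleftrightarrow> (\<forall>x\<in>X - Y. \<forall>y\<in>X - Y. lk Y x y)"

text \<open>A finite vertex set is tight if deleting it leaves two full components. Only for tight sets
  does nestedness become symmetric.\<close>

definition tight :: "'a set \<Rightarrow> bool" where
  "tight X \<longleftrightarrow> finite X \<and> X \<subseteq> V \<and> (\<exists>C D. full X C \<and> full X D \<and> C \<inter> D = {})"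

lemma full_comp:
  assumes "full X C" "c \<in> C" shows "C = {w. lk X c w}"
proof -
  obtain u where u: "C = {w. lk X u w}" using assms(1) unfolding full_def by auto
  then have "lk X u c" using assms(2) by simp
  then have "lk X u w \<longleftrightarrow> lk X c w" for w using lk_trans lk_sym[of X u c] by metis
  then show ?thesis using u by simp
qed

lemma full_lk: "full X C \<Longrightarrow> c \<in> C \<Longrightarrow> d \<in> C \<Longrightarrow> lk X c d"
  using full_comp[of X C c] by simp

lemma full_closed: "full X C \<Longrightarrow> c \<in> C \<Longrightarrow> lk X c d \<Longrightarrow> d \<in> C"
  using full_comp[of X C c] by simp

lemma full_nonempty: "full X C \<Longrightarrow> C \<noteq> {}"
  unfolding full_def by auto

lemma full_in: "full X C \<Longrightarrow> c \<in> C \<Longrightarrow> c \<in> V \<and> c \<notin> X"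
  using full_lk[of X C c c] lk_in[of X c c] by simp

lemma full_disj: "full X C \<Longrightarrow> C \<inter> X = {}"
  using full_in by blast

lemma full_nbr: "full X C \<Longrightarrow> x \<in> X \<Longrightarrow> \<exists>c\<in>C. {x, c} \<in> E"
  unfolding full_def by simp

lemma full_step: "full X C \<Longrightarrow> c \<in> C \<Longrightarrow> {c, d} \<in> E \<Longrightarrow> d \<notin> X \<Longrightarrow> d \<in> C"
  using full_closed[of X C c d] lk_edge[of c d X] full_in[of X C c] by simp

lemma full_eq:
  assumes "full X C" "full X D" "C \<inter> D \<noteq> {}" shows "C = D"
proof -
  obtain c where "c \<in> C" "c \<in> D" using assms(3) by auto
  then have "d \<in> C \<longleftrightarrow> d \<in> D" for d
    using full_lk[OF assms(1), of c d] full_lk[OF assms(2), of c d]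
      full_closed[OF assms(1), of c d] full_closed[OF assms(2), of c d] by blast
  then show ?thesis by blast
qed

text \<open>A full component that survives the deletion of \<open>X\<close> holds together the rest of its
  separator.\<close>

lemma full_avoid_lk:
  assumes "full Y D" "D \<inter> X = {}" "x \<in> D \<union> (Y - X)" "y \<in> D \<union> (Y - X)"
  shows "lk X x y"
proof -
  obtain d where d: "d \<in> D" using assms(1) full_nonempty by blast
  have D: "lk X d e" if "e \<in> D" for e
    using lk_avoid[OF full_lk[OF assms(1) d that]] full_closed[OF assms(1) d] assms(2) by blast
  have "lk X d z" if "z \<in> D \<union> (Y - X)" for z
  proof (cases "z \<in> D")
    case False
    then have "z \<in> Y" "z \<notin> X" using that by auto
    then obtain e where "e \<in> D" "{e, z} \<in> E"
      using full_nbr[OF assms(1)] using edge_sym by blast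
    then show ?thesis using D lk_step \<open>z \<notin> X\<close> by blast
  qed (use D in blast)
  then show ?thesis using assms(3,4) lk_trans[OF lk_sym[of X d x]] by blast
qed

lemma full_avoid_snest:
  assumes "full Y D" "D \<inter> X = {}" shows "snest Y X"
  using full_avoid_lk[OF assms] by (simp add: snest_def)

text \<open>If \<open>Y\<close> does not separate \<open>X\<close>, then \<open>X\<close> meets at most one component of \<open>G - Y\<close>.\<close>

lemma snest_disjoint_full:
  assumes "snest X Y" "full Y C" "full Y D" "C \<inter> D = {}"
  shows "C \<inter> X = {} \<or> D \<inter> X = {}"
proof (rule ccontr)
  assume "\<not> ?thesis"
  then obtain c d where "c \<in> C" "c \<in> X" "d \<in> D" "d \<in> X" by blast
  moreover have "c \<notin> Y" "d \<notin> Y" using calculation full_disj assms(2,3) by blast+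
  ultimately have "lk Y c d" using assms(1) by (auto simp: snest_def)
  then show False using full_closed[OF assms(2) \<open>c \<in> C\<close>] \<open>d \<in> D\<close> assms(4) by blast
qed

lemma snest_sym:
  assumes "snest X Y" "tight Y" shows "snest Y X"
proof -
  obtain C D where CD: "full Y C" "full Y D" "C \<inter> D = {}"
    using assms(2) by (auto simp: tight_def)
  with snest_disjoint_full[OF assms(1) CD] show ?thesis
    using full_avoid_snest by blast
qed

text \<open>Whatever is nested with two crossing separators is nested with every separator contained
  in their union, in particular with the separators of their corners.\<close>

lemma snest_union:
  assumes "tight W" "tight X" "tight Y" "\<not> snest X Y" "snest X W" "snest Y W" "X' \<subseteq> X \<union> Y"
  shows "snest X' W"
proof -
  obtain C D where CD: "full Y C" "full Y D" "C \<inter> D = {}"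
    using assms(3) by (auto simp: tight_def)
  have "snest W Y" using snest_sym[OF assms(6,1)] .
  from snest_disjoint_full[OF this CD] obtain F where F: "full Y F" "F \<inter> W = {}"
    using CD(1,2) by auto
  \<comment> \<open>As \<open>X\<close> crosses \<open>Y\<close>, it meets all full components of \<open>G - Y\<close>; the one that avoids \<open>W\<close>
    connects \<open>X\<close> to \<open>Y\<close> in \<open>G - W\<close>.\<close>
  have "F \<inter> X \<noteq> {}"
    using full_avoid_snest[OF F(1), of X] snest_sym[OF _ assms(2)] assms(4) by blast
  then obtain f where f: "f \<in> F" "f \<in> X" "f \<notin> W" using F by blast
  have "lk W f z" if z: "z \<in> (X \<union> Y) - W" for z
  proof (cases "z \<in> X")
    case True
    then show ?thesis using assms(5) f z by (auto simp: snest_def)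
  next
    case False
    then show ?thesis using full_avoid_lk[OF F, of f z] f z by blast
  qed
  then have "lk W x y" if "x \<in> X' - W" "y \<in> X' - W" for x y
    using that assms(7) lk_trans[OF lk_sym[of W f x]] by blast
  then show ?thesis unfolding snest_def by blast
qed

section \<open>Every tight separator crosses only finitely many others of given order\<close>

lemma lk_finite_path:
  assumes "lk S u v"
  shows "\<exists>P. finite P \<and> P \<inter> S = {} \<and> (\<forall>T. T \<inter> P = {} \<longrightarrow> lk T u v)"
  using assms
proof (induction rule: lk_induct)
  case refl
  then show ?case using lk_in[OF assms] by (intro exI[of _ "{u}"]) (auto intro: lk_refl)
next
  case (step x y)
  then obtain P where P: "finite P" "P \<inter> S = {}" "\<forall>T. T \<inter> P = {} \<longrightarrow> lk T u x" by blast
  show ?case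
  proof (intro exI conjI allI impI)
    show "finite (insert y P)" "insert y P \<inter> S = {}" using P step by auto
    show "lk T u y" if "T \<inter> insert y P = {}" for T
      using that P(3) step.hyps(2) lk_step[of T u x y] by blast
  qed
qed

text \<open>There are only finitely many minimal \<open>u\<close>--\<open>v\<close> separators of order \<open>k\<close>. The set \<open>S\<close> of
  vertices already deleted makes the induction go through: each such separator contains one of
  the finitely many vertices of a fixed path from \<open>u\<close> to \<open>v\<close>.\<close>

lemma finite_minimal_separators:
  "finite {Y. finite Y \<and> card Y = k \<and> \<not> lk (S \<union> Y) u v \<and> (\<forall>y\<in>Y. lk (S \<union> (Y - {y})) u v)}"
    (is "finite (?M k S)")
proof (induction k arbitrary: S)
  case 0
  have "?M 0 S \<subseteq> {{}}" by auto
  then show ?case using finite_subset by blast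
next
  case (Suc k)
  show ?case
  proof (cases "lk S u v")
    case False
    have "?M (Suc k) S = {}"
    proof (rule ccontr)
      assume "?M (Suc k) S \<noteq> {}"
      then obtain Y where Y: "card Y = Suc k" "\<forall>y\<in>Y. lk (S \<union> (Y - {y})) u v" by blast
      then obtain y where "y \<in> Y" by fastforce
      then show False using Y(2) False lk_mono by blast
    qed
    then show ?thesis by (simp only: finite.emptyI)
  next
    case True
    then obtain P where P: "finite P" "\<forall>T. T \<inter> P = {} \<longrightarrow> lk T u v" "P \<inter> S = {}"
      using lk_finite_path[OF True] by metis
    have "?M (Suc k) S \<subseteq> (\<Union>p\<in>P. insert p ` ?M k (insert p S))"
    proof
      fix Y assume "Y \<in> ?M (Suc k) S"
      then have Y: "finite Y" "card Y = Suc k" "\<not> lk (S \<union> Y) u v"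
        "\<And>y. y \<in> Y \<Longrightarrow> lk (S \<union> (Y - {y})) u v" by auto
      have "(S \<union> Y) \<inter> P \<noteq> {}" using P(2) Y(3) by metis
      then obtain p where p: "p \<in> P" "p \<in> Y" using P(3) by auto
      have eq: "insert p S \<union> (Y - {p}) = S \<union> Y" using p by blast
      have "lk (insert p S \<union> (Y - {p} - {y})) u v" if "y \<in> Y - {p}" for y
      proof -
        have "insert p S \<union> (Y - {p} - {y}) \<subseteq> S \<union> (Y - {y})" using p that by blast
        then show ?thesis using lk_mono[OF Y(4)[of y]] that by simp
      qed
      then have "Y - {p} \<in> ?M k (insert p S)" using Y p eq by simp
      moreover have "Y = insert p (Y - {p})" using p by blast
      ultimately show "Y \<in> (\<Union>p\<in>P. insert p ` ?M k (insert p S))" using p(1) by blast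
    qed
    moreover have "finite (\<Union>p\<in>P. insert p ` ?M k (insert p S))"
      using P(1) Suc.IH by (intro finite_UN_I finite_imageI)
    ultimately show ?thesis by (rule finite_subset)
  qed
qed

text \<open>If \<open>Y\<close> crosses \<open>X\<close>, then \<open>X\<close> has a vertex in each full component of \<open>G - Y\<close>, and \<open>Y\<close> is
  a minimal separator of two such vertices.\<close>

lemma finite_crossing:
  assumes "finite X"
  shows "finite {Y. tight Y \<and> card Y = k \<and> \<not> snest Y X}"
proof -
  let ?M = "\<lambda>u v. {Y. finite Y \<and> card Y = k \<and> \<not> lk ({} \<union> Y) u v \<and>
    (\<forall>y\<in>Y. lk ({} \<union> (Y - {y})) u v)}"
  have "{Y. tight Y \<and> card Y = k \<and> \<not> snest Y X} \<subseteq> (\<Union>u\<in>X. \<Union>v\<in>X. ?M u v)"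
  proof
    fix Y assume "Y \<in> {Y. tight Y \<and> card Y = k \<and> \<not> snest Y X}"
    then have Y: "tight Y" "card Y = k" "\<not> snest Y X" by auto
    then obtain C D where CD: "full Y C" "full Y D" "C \<inter> D = {}" by (auto simp: tight_def)
    obtain u where u: "u \<in> C" "u \<in> X" using full_avoid_snest[OF CD(1)] Y(3) by blast
    obtain v where v: "v \<in> D" "v \<in> X" using full_avoid_snest[OF CD(2)] Y(3) by blast
    have "lk (Y - {y}) u v" if y: "y \<in> Y" for y
    proof -
      have "lk (Y - {y}) u y"
        using full_avoid_lk[OF CD(1), of "Y - {y}" u y] full_disj[OF CD(1)] u y by blast
      moreover have "lk (Y - {y}) y v"
        using full_avoid_lk[OF CD(2), of "Y - {y}" y v] full_disj[OF CD(2)] v y by blast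
      ultimately show ?thesis by (rule lk_trans)
    qed
    moreover have "\<not> lk Y u v" using full_closed[OF CD(1) u(1)] CD(3) v by blast
    ultimately have "Y \<in> ?M u v" using Y by (auto simp: tight_def)
    then show "Y \<in> (\<Union>u\<in>X. \<Union>v\<in>X. ?M u v)" using u v by blast
  qed
  moreover have "finite (\<Union>u\<in>X. \<Union>v\<in>X. ?M u v)"
    using assms finite_minimal_separators by (intro finite_UN_I)
  ultimately show ?thesis by (rule finite_subset)
qed


section \<open>Rays and efficient separations\<close>

text \<open>The set \<open>A\<close> contains a tail of \<open>r\<close>.\<close>

definition tail_in :: "(nat \<Rightarrow> 'a) \<Rightarrow> 'a set \<Rightarrow> bool" where
  "tail_in r A \<longleftrightarrow> (\<forall>\<^sub>F n in sequentially. r n \<in> A)"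

text \<open>The component of \<open>G - X\<close> that contains a tail of \<open>r\<close>, where \<open>X\<close> is finite.\<close>

definition ray_comp :: "'a set \<Rightarrow> (nat \<Rightarrow> 'a) \<Rightarrow> 'a set" where
  "ray_comp X r = {w. \<forall>\<^sub>F n in sequentially. lk X (r n) w}"

text \<open>The separation \<open>s\<close> has finite order and distinguishes \<open>r\<close> from \<open>r'\<close>, with \<open>r\<close> in its first and \<open>r'\<close>
  in its second side. This is an oriented notion, so that its reverse swaps the two rays.\<close>

definition sides :: "'a sep \<Rightarrow> (nat \<Rightarrow> 'a) \<Rightarrow> (nat \<Rightarrow> 'a) \<Rightarrow> bool" where
  "sides s r r' \<longleftrightarrow> finite_order_separation V E s \<and> tail_in r (fst s) \<and> tail_in r' (snd s)"

text \<open>It does so efficiently. By symmetry the minimum may be taken over separations with the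
  same orientation.\<close>

definition eff :: "'a sep \<Rightarrow> (nat \<Rightarrow> 'a) \<Rightarrow> (nat \<Rightarrow> 'a) \<Rightarrow> bool" where
  "eff s r r' \<longleftrightarrow> sides s r r' \<and> (\<forall>t. sides t r r' \<longrightarrow> sep_order s \<le> sep_order t)"

lemma tail_in_mono: "tail_in r A \<Longrightarrow> A \<subseteq> B \<Longrightarrow> tail_in r B"
  unfolding tail_in_def by (auto elim: eventually_mono)

lemma tail_in_Int: "tail_in r A \<Longrightarrow> tail_in r B \<Longrightarrow> tail_in r (A \<inter> B)"
  unfolding tail_in_def by (simp add: eventually_conj)

lemma tail_in_nonempty: "tail_in r A \<Longrightarrow> A \<noteq> {}"
  unfolding tail_in_def by (auto simp: eventually_sequentially)

lemma tail_in_infinite: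
  assumes "r \<in> rays V E" "tail_in r A" shows "infinite A"
proof
  assume "finite A"
  obtain n where n: "\<And>m. m \<ge> n \<Longrightarrow> r m \<in> A"
    using assms(2) by (auto simp: tail_in_def eventually_sequentially)
  have "inj_on r {n..}" using assms(1) by (auto simp: rays_def intro: inj_on_subset)
  moreover have "finite (r ` {n..})" using n \<open>finite A\<close> by (auto intro: finite_subset)
  ultimately show False using finite_imageD infinite_Ici by blast
qed

lemma tail_avoids_finite:
  assumes "r \<in> rays V E" "finite X" shows "\<forall>\<^sub>F n in sequentially. r n \<in> V - X"
proof -
  have "finite {n. r n \<in> X}"
    using assms finite_vimageI[of X r] by (simp add: rays_def vimage_def)
  then obtain n where "\<forall>m\<in>{n. r n \<in> X}. m < n" using finite_nat_set_iff_bounded by auto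
  then have "\<forall>m\<ge>n. r m \<in> V - X" using assms(1) by (auto simp: rays_def leD)
  then show ?thesis by (auto simp: eventually_sequentially)
qed

lemma tail_linked:
  assumes "r \<in> rays V E" "finite X"
  shows "\<exists>n. \<forall>m\<ge>n. lk X (r n) (r m)"
proof -
  obtain n where n: "\<And>m. m \<ge> n \<Longrightarrow> r m \<in> V - X"
    using tail_avoids_finite[OF assms] by (auto simp: eventually_sequentially)
  have "lk X (r n) (r m)" if "m \<ge> n" for m
    using that
  proof (induction m rule: dec_induct)
    case base
    then show ?case using n lk_refl by simp
  next
    case (step m)
    have "{r m, r (Suc m)} \<in> E" using assms(1) by (simp add: rays_def)
    then show ?case using lk_step[OF step.IH] n[of "Suc m"] step.hyps by simp
  qed
  then show ?thesis by blast
qed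

lemma ray_comp_eq:
  assumes "r \<in> rays V E" "finite X"
  shows "\<exists>n. (\<forall>m\<ge>n. r m \<in> ray_comp X r) \<and> ray_comp X r = {w. lk X (r n) w}"
proof -
  obtain n where n: "\<And>m. m \<ge> n \<Longrightarrow> lk X (r n) (r m)" using tail_linked[OF assms] by blast
  have "w \<in> ray_comp X r \<longleftrightarrow> lk X (r n) w" for w
  proof
    assume "w \<in> ray_comp X r"
    then obtain k where k: "\<And>m. m \<ge> k \<Longrightarrow> lk X (r m) w"
      by (auto simp: ray_comp_def eventually_sequentially)
    show "lk X (r n) w" using lk_trans[OF n k, of "max n k"] by simp
  next
    assume w: "lk X (r n) w"
    have "lk X (r m) w" if "m \<ge> n" for m using lk_trans[OF lk_sym[OF n[OF that]] w] .
    then show "w \<in> ray_comp X r" by (auto simp: ray_comp_def eventually_sequentially)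
  qed
  then have "ray_comp X r = {w. lk X (r n) w}" by auto
  then show ?thesis using n by auto
qed

lemma tail_in_ray_comp: "r \<in> rays V E \<Longrightarrow> finite X \<Longrightarrow> tail_in r (ray_comp X r)"
  using ray_comp_eq[of r X] by (auto simp: tail_in_def eventually_sequentially)

lemma ray_comp_in: "r \<in> rays V E \<Longrightarrow> finite X \<Longrightarrow> w \<in> ray_comp X r \<Longrightarrow> w \<in> V \<and> w \<notin> X"
  using ray_comp_eq[of r X] lk_in by auto

lemma ray_comp_closed:
  assumes "r \<in> rays V E" "finite X" "w \<in> ray_comp X r" "{w, y} \<in> E" "y \<notin> X"
  shows "y \<in> ray_comp X r"
  using ray_comp_eq[OF assms(1,2)] assms(3-5) lk_step by auto

lemma sep_tails:
  assumes "r \<in> rays V E" "separation V E (A, B)" "finite (A \<inter> B)"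
  shows "ray_comp (A \<inter> B) r \<subseteq> A - B \<or> ray_comp (A \<inter> B) r \<subseteq> B - A"
proof -
  obtain n where n: "r n \<in> ray_comp (A \<inter> B) r" "ray_comp (A \<inter> B) r = {w. lk (A \<inter> B) (r n) w}"
    using ray_comp_eq[OF assms(1,3)] by auto
  have "r n \<in> A \<or> r n \<in> B"
    using ray_comp_in[OF assms(1,3) n(1)] assms(2) by (auto simp: separation_def)
  then show ?thesis
  proof
    assume "r n \<in> A"
    then have "ray_comp (A \<inter> B) r \<subseteq> A - B" using lk_separation[OF assms(2)] n(2) by blast
    then show ?thesis ..
  next
    assume "r n \<in> B"
    then have "ray_comp (A \<inter> B) r \<subseteq> B - A"
      using lk_separation[OF separation_swap[OF assms(2)]] n(2) by (auto simp: Int_commute)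
    then show ?thesis ..
  qed
qed

lemma fos_iff:
  "finite_order_separation V E (A, B) \<longleftrightarrow> separation V E (A, B) \<and> finite (A \<inter> B)"
  by (simp add: finite_order_separation_def separator_def)

lemma fos_swap: "finite_order_separation V E (A, B) \<Longrightarrow> finite_order_separation V E (B, A)"
  using separation_swap by (auto simp: fos_iff Int_commute)

lemma tail_cases:
  assumes "r \<in> rays V E" "finite_order_separation V E (A, B)"
  shows "tail_in r A \<or> tail_in r B"
  using sep_tails[of r A B] tail_in_ray_comp[of r "A \<inter> B"] tail_in_mono assms
  by (meson Diff_subset fos_iff subset_trans)

lemma tail_not_both:
  assumes "r \<in> rays V E" "finite_order_separation V E (A, B)" "tail_in r A"
  shows "\<not> tail_in r B"
  using tail_in_infinite[OF assms(1)] tail_in_Int[OF assms(3)] assms(2) by (auto simp: fos_iff)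

lemma ray_comp_side:
  assumes "r \<in> rays V E" "finite_order_separation V E (A, B)" "tail_in r A"
  shows "ray_comp (A \<inter> B) r \<subseteq> A - B"
proof (rule ccontr)
  assume "\<not> ?thesis"
  then have "ray_comp (A \<inter> B) r \<subseteq> B" using sep_tails[of r A B] assms by (auto simp: fos_iff)
  then have "tail_in r B"
    using tail_in_ray_comp[of r "A \<inter> B"] tail_in_mono assms by (auto simp: fos_iff)
  then show False using tail_not_both assms by blast
qed

lemma separator_reverse [simp]: "separator (sep_reverse s) = separator s"
  by (auto simp: separator_def sep_reverse_def split: prod.splits)

lemma sep_order_reverse [simp]: "sep_order (sep_reverse s) = sep_order s"
  by (simp add: sep_order_def)

lemma sides_reverse: "sides s r r' \<Longrightarrow> sides (sep_reverse s) r' r"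
  using fos_swap by (cases s) (auto simp: sides_def sep_reverse_def)

lemma eff_reverse:
  assumes "eff s r r'" shows "eff (sep_reverse s) r' r"
  using assms sides_reverse[of s r r'] sides_reverse[of _ r' r] unfolding eff_def
  by (metis sep_order_reverse)

lemma eff_order_eq: "eff s r r' \<Longrightarrow> eff t r r' \<Longrightarrow> sep_order s = sep_order t"
  unfolding eff_def by (blast intro: le_antisym)

lemma eff_le: "eff s r r' \<Longrightarrow> sides t r r' \<Longrightarrow> sep_order s \<le> sep_order t"
  unfolding eff_def by blast

lemma eff_of_le: "eff s r r' \<Longrightarrow> sides t r r' \<Longrightarrow> sep_order t \<le> sep_order s \<Longrightarrow> eff t r r'"
  unfolding eff_def using le_trans by blast

text \<open>Deleting a vertex without a neighbour in the component of \<open>r\<close> from the separator of an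
  efficient separation would give a distinguishing separation of smaller order.\<close>

lemma eff_full:
  assumes "eff (A, B) r r'" "r \<in> rays V E" "r' \<in> rays V E"
  shows "full (A \<inter> B) (ray_comp (A \<inter> B) r)"
proof -
  let ?X = "A \<inter> B" let ?C = "ray_comp ?X r"
  have fos: "finite_order_separation V E (A, B)" and tl: "tail_in r A" "tail_in r' B"
    using assms(1) by (auto simp: eff_def sides_def)
  then have sep: "separation V E (A, B)" and fin: "finite ?X" by (auto simp: fos_iff)
  obtain n where n: "r n \<in> ?C" "?C = {w. lk ?X (r n) w}"
    using ray_comp_eq[OF assms(2) fin] by auto
  have CA: "?C \<subseteq> A - B" using ray_comp_side[OF assms(2) fos tl(1)] .
  have AV: "A \<subseteq> V" "B \<subseteq> V" using sep by (auto simp: separation_def)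
  have "\<exists>c\<in>?C. {x, c} \<in> E" if x: "x \<in> ?X" for x
  proof (rule ccontr)
    assume no: "\<not> ?thesis"
    let ?s = "(?C \<union> (?X - {x}), V - ?C)"
    have "separation V E ?s"
    proof -
      have "{c, d} \<notin> E" if "c \<in> ?C" "d \<in> V - ?C - (?X - {x})" for c d
      proof
        assume e: "{c, d} \<in> E"
        show False
        proof (cases "d = x")
          case True
          then show False using no e edge_sym that(1) by blast
        next
          case False
          then have "d \<notin> ?X" using that(2) by blast
          then show False using ray_comp_closed[OF assms(2) fin that(1) e] that(2) by blast
        qed
      qed
      then show ?thesis using CA AV by (auto simp: separation_def)
    qed
    moreover have int: "(?C \<union> (?X - {x})) \<inter> (V - ?C) = ?X - {x}" using CA AV by blast
    moreover have "tail_in r (?C \<union> (?X - {x}))"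
      using tail_in_ray_comp[OF assms(2) fin] by (rule tail_in_mono) blast
    moreover have "tail_in r' (V - ?C)"
      by (rule tail_in_mono[OF tl(2)]) (use CA AV in blast)
    ultimately have "sides ?s r r'" using fin by (simp add: sides_def fos_iff)
    then have "sep_order (A, B) \<le> sep_order ?s" by (rule eff_le[OF assms(1)])
    moreover have "sep_order ?s < sep_order (A, B)"
      using int x fin card_Diff1_less[of ?X x] by (simp add: sep_order_def separator_def)
    ultimately show False by simp
  qed
  then show ?thesis using n unfolding full_def by blast
qed

lemma eff_full':
  assumes "eff (A, B) r r'" "r \<in> rays V E" "r' \<in> rays V E"
  shows "full (A \<inter> B) (ray_comp (A \<inter> B) r')"
  using eff_full[of B A r' r] eff_reverse[OF assms(1)] assms
  by (simp add: sep_reverse_def Int_commute)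

lemma eff_comps:
  assumes "eff (A, B) r r'" "r \<in> rays V E" "r' \<in> rays V E"
  shows "ray_comp (A \<inter> B) r \<subseteq> A - B" "ray_comp (A \<inter> B) r' \<subseteq> B - A"
proof -
  have fos: "finite_order_separation V E (A, B)" and tl: "tail_in r A" "tail_in r' B"
    using assms(1) by (auto simp: eff_def sides_def)
  show "ray_comp (A \<inter> B) r \<subseteq> A - B" by (rule ray_comp_side[OF assms(2) fos tl(1)])
  show "ray_comp (A \<inter> B) r' \<subseteq> B - A"
    using ray_comp_side[OF assms(3) fos_swap[OF fos] tl(2)] by (simp add: Int_commute)
qed

lemma eff_tight:
  assumes "eff s r r'" "r \<in> rays V E" "r' \<in> rays V E" shows "tight (separator s)"
proof -
  obtain A B where s: "s = (A, B)" by (cases s)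
  have "finite (A \<inter> B)" "A \<inter> B \<subseteq> V"
    using assms(1) s by (auto simp: eff_def sides_def fos_iff separation_def)
  moreover have "ray_comp (A \<inter> B) r \<inter> ray_comp (A \<inter> B) r' = {}"
    using eff_comps[OF assms[unfolded s]] by blast
  ultimately show ?thesis
    using eff_full[OF assms[unfolded s]] eff_full'[OF assms[unfolded s]]
    unfolding tight_def s separator_def by auto
qed

section \<open>Corners\<close>

text \<open>The separation that cuts off the intersection of the two first sides. Reversing one or both
  separations yields the other three corners of the pair.\<close>

definition corner :: "'a sep \<Rightarrow> 'a sep \<Rightarrow> 'a sep" where
  "corner s t = (fst s \<inter> fst t, snd s \<union> snd t)"

lemma corner_sides:
  assumes "finite_order_separation V E s" "finite_order_separation V E t"
    and "tail_in r (fst s)" "tail_in r (fst t)" "tail_in r' (snd s) \<or> tail_in r' (snd t)"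
  shows "sides (corner s t) r r'"
proof -
  obtain A B C D where st: "s = (A, B)" "t = (C, D)" by (cases s, cases t)
  have sep: "separation V E (A, B)" "separation V E (C, D)" "finite (A \<inter> B)" "finite (C \<inter> D)"
    using assms(1,2) st by (auto simp: fos_iff)
  have "finite ((A \<inter> C) \<inter> (B \<union> D))"
    by (rule finite_subset[of _ "(A \<inter> B) \<union> (C \<inter> D)"]) (use sep in auto)
  moreover have "separation V E (A \<inter> C, B \<union> D)"
  proof -
    have "{a, b} \<notin> E" if "a \<in> (A \<inter> C) - (B \<union> D)" "b \<in> (B \<union> D) - (A \<inter> C)" for a b
      using separation_edge[OF sep(1), of a b] separation_edge[OF sep(2), of a b] that by blast
    moreover have "(A \<inter> C) \<union> (B \<union> D) = V" using sep(1,2) by (auto simp: separation_def)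
    ultimately show ?thesis by (simp add: separation_def)
  qed
  moreover have "tail_in r (A \<inter> C)" using assms(3,4) st tail_in_Int by simp
  moreover have "tail_in r' (B \<union> D)" using assms(5) st tail_in_mono[of r' _ "B \<union> D"] by auto
  ultimately show ?thesis by (simp add: sides_def corner_def st fos_iff)
qed

lemma corner_separator: "separator (corner s t) \<subseteq> separator s \<union> separator t"
  by (cases s, cases t) (auto simp: corner_def separator_def)

text \<open>Opposite corners: the two separators have the same union and the same intersection as the
  separators of \<open>s\<close> and \<open>t\<close>.\<close>

lemma corner_order:
  assumes "finite_order_separation V E s" "finite_order_separation V E t"
  shows "sep_order (corner s t) + sep_order (corner (sep_reverse s) (sep_reverse t)) =
    sep_order s + sep_order t"
proof -
  obtain A B C D where st: "s = (A, B)" "t = (C, D)" by (cases s, cases t)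
  let ?P = "(A \<inter> C) \<inter> (B \<union> D)" and ?Q = "(B \<inter> D) \<inter> (A \<union> C)"
  have sep: "A \<union> B = V" "C \<union> D = V" "finite (A \<inter> B)" "finite (C \<inter> D)"
    using assms st by (auto simp: fos_iff separation_def)
  have fin: "finite ?P" "finite ?Q"
    by (rule finite_subset[of _ "(A \<inter> B) \<union> (C \<inter> D)"]; use sep in auto)+
  have un: "?P \<union> ?Q = (A \<inter> B) \<union> (C \<inter> D)" using sep(1,2) by auto
  have int: "?P \<inter> ?Q = (A \<inter> B) \<inter> (C \<inter> D)" by auto
  have "card ?P + card ?Q = card (A \<inter> B) + card (C \<inter> D)"
    using card_Un_Int[OF fin] card_Un_Int[OF sep(3,4)] un int by simp
  then show ?thesis
    by (simp add: st sep_order_def separator_def corner_def sep_reverse_def)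
qed

lemma corner_snest:
  assumes "eff (corner s t) r r'" "r \<in> rays V E" "r' \<in> rays V E"
  shows "snest (separator (corner s t)) (separator s)"
    "snest (separator (corner s t)) (separator t)"
proof -
  obtain A B C D where st: "s = (A, B)" "t = (C, D)" by (cases s, cases t)
  have e: "eff (A \<inter> C, B \<union> D) r r'" using assms(1) by (simp add: corner_def st)
  note f = eff_full[OF e assms(2,3)] and c = eff_comps(1)[OF e assms(2,3)]
  show "snest (separator (corner s t)) (separator s)"
    "snest (separator (corner s t)) (separator t)"
    using full_avoid_snest[OF f, of "A \<inter> B"] full_avoid_snest[OF f, of "C \<inter> D"] c
    by (auto simp: separator_def corner_def st)
qed


section \<open>Uncrossing efficient separations\<close>

lemma reverse_simps [simp]:
  "sep_reverse (sep_reverse s) = s" "fst (sep_reverse s) = snd s" "snd (sep_reverse s) = fst s"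
  by (auto simp: sep_reverse_def split: prod.splits)

lemma fos_reverse: "finite_order_separation V E s \<Longrightarrow> finite_order_separation V E (sep_reverse s)"
  using fos_swap by (cases s) (auto simp: sep_reverse_def)

lemma eff_sides: "eff s r r' \<Longrightarrow> sides s r r'"
  unfolding eff_def by blast

lemma eff_fos: "eff s r r' \<Longrightarrow> finite_order_separation V E s"
  unfolding eff_def sides_def by blast

lemma eff_tails: "eff s r r' \<Longrightarrow> tail_in r (fst s) \<and> tail_in r' (snd s)"
  unfolding eff_def sides_def by blast

lemma tail_cases_sep:
  "r \<in> rays V E \<Longrightarrow> finite_order_separation V E s \<Longrightarrow> tail_in r (fst s) \<or> tail_in r (snd s)"
  using tail_cases by (cases s) auto

lemma eff_exists:
  assumes "sides s r r'" shows "\<exists>t. eff t r r'"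
  using ex_has_least_nat[of "\<lambda>t. sides t r r'" s sep_order] assms unfolding eff_def by blast

text \<open>If \<open>s\<close> leaves \<open>n\<close> and \<open>n'\<close> on the same side, then of two opposite corners one distinguishes
  \<open>w\<close> and \<open>w'\<close>, hence has at least the order of \<open>s\<close>. So the other one, which distinguishes \<open>n\<close>
  and \<open>n'\<close>, has at most the order of \<open>t\<close>.\<close>

lemma uncross_lower_corner:
  assumes s: "eff s w w'" and t: "eff t n n'"
    and n: "tail_in n (fst s)" "tail_in n' (fst s)" and w: "tail_in w' (fst t)"
  shows "eff (corner s (sep_reverse t)) n' n"
proof -
  let ?P = "corner (sep_reverse s) t" and ?Q = "corner s (sep_reverse t)"
  have fos: "finite_order_separation V E s" "finite_order_separation V E t"
    using s t eff_fos by auto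
  have "sides ?P w' w"
    using corner_sides[OF fos_reverse[OF fos(1)] fos(2), of w' w] eff_tails[OF s] w by simp
  then have "sep_order s \<le> sep_order ?P" using eff_le[OF eff_reverse[OF s]] by simp
  moreover have "sep_order ?P + sep_order ?Q = sep_order s + sep_order t"
    using corner_order[OF fos_reverse[OF fos(1)] fos(2)] by simp
  ultimately have "sep_order ?Q \<le> sep_order t" by simp
  moreover have "sides ?Q n' n"
    using corner_sides[OF fos(1) fos_reverse[OF fos(2)], of n' n] eff_tails[OF t] n by simp
  ultimately show ?thesis using eff_of_le[OF eff_reverse[OF t]] by simp
qed

lemma uncross_lower_side:
  assumes rays: "w' \<in> rays V E" "n \<in> rays V E" "n' \<in> rays V E"
    and s: "eff s w w'" and t: "eff t n n'"
    and n: "tail_in n (fst s)" "tail_in n' (fst s)"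
  shows "\<exists>u. eff u n n' \<and> separator u \<subseteq> separator s \<union> separator t \<and>
    snest (separator u) (separator s)"
proof (cases "tail_in w' (fst t)")
  case True
  let ?u = "corner s (sep_reverse t)"
  have e: "eff ?u n' n" using uncross_lower_corner[OF s t n True] .
  then show ?thesis
    using eff_reverse[OF e] corner_separator[of s "sep_reverse t"] corner_snest(1)[OF e rays(3,2)]
    by (intro exI[of _ "sep_reverse ?u"]) simp
next
  case False
  then have w: "tail_in w' (fst (sep_reverse t))"
    using tail_cases_sep[OF rays(1) eff_fos[OF t]] by simp
  let ?u = "corner s t"
  have e: "eff ?u n n'"
    using uncross_lower_corner[OF s eff_reverse[OF t] n(2,1) w] by simp
  then show ?thesis
    using corner_separator[of s t] corner_snest(1)[OF e rays(2,3)] by (intro exI[of _ ?u]) simp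
qed

text \<open>A separation of larger order can be replaced by an equally good one that is nested with \<open>s\<close>.\<close>

lemma uncross_lower:
  assumes rays: "w \<in> rays V E" "w' \<in> rays V E" "n \<in> rays V E" "n' \<in> rays V E"
    and s: "eff s w w'" and t: "eff t n n'" and less: "sep_order s < sep_order t"
  shows "\<exists>u. eff u n n' \<and> separator u \<subseteq> separator s \<union> separator t \<and>
    snest (separator u) (separator s)"
proof -
  have fos: "finite_order_separation V E s" using eff_fos[OF s] .
  \<comment> \<open>The order of \<open>s\<close> is too small to distinguish \<open>n\<close> and \<open>n'\<close>.\<close>
  have "\<not> sides s n n'" using eff_le[OF t, of s] less by auto
  moreover have "\<not> sides (sep_reverse s) n n'" using eff_le[OF t, of "sep_reverse s"] less by auto
  ultimately consider "tail_in n (fst s)" "tail_in n' (fst s)"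
    | "tail_in n (snd s)" "tail_in n' (snd s)"
    using tail_cases_sep[OF rays(3) fos] tail_cases_sep[OF rays(4) fos] fos fos_reverse[OF fos]
    unfolding sides_def by auto
  then show ?thesis
  proof cases
    case 1
    then show ?thesis using uncross_lower_side[OF rays(2,3,4) s t] by blast
  next
    case 2
    then show ?thesis
      using uncross_lower_side[OF rays(1,3,4) eff_reverse[OF s] t] by simp
  qed
qed

section \<open>Crossing numbers\<close>

text \<open>The separators of order \<open>k\<close> that separate some two rays efficiently, and those among them
  that cross \<open>X\<close>.\<close>

definition level :: "nat \<Rightarrow> 'a set set" where
  "level k = {X. \<exists>s. \<exists>r\<in>rays V E. \<exists>r'\<in>rays V E. eff s r r' \<and> sep_order s = k \<and> X = separator s}"

definition crossing :: "nat \<Rightarrow> 'a set \<Rightarrow> 'a set set" where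
  "crossing k X = {W \<in> level k. \<not> snest W X}"

lemma levelI:
  "eff s r r' \<Longrightarrow> r \<in> rays V E \<Longrightarrow> r' \<in> rays V E \<Longrightarrow> sep_order s = k \<Longrightarrow> separator s \<in> level k"
  unfolding level_def by blast

lemma level_tight: "X \<in> level k \<Longrightarrow> tight X \<and> card X = k"
  unfolding level_def using eff_tight by (auto simp: sep_order_def)

lemma finite_crossing_level: "finite X \<Longrightarrow> finite (crossing k X)"
  by (rule finite_subset[OF _ finite_crossing[of X k]]) (auto simp: crossing_def level_tight)

text \<open>A set whose vertices outside the separator of \<open>s\<close> are not separated by it lies, up to the separator,
  on one side of \<open>s\<close>.\<close>

lemma snest_side:
  assumes "finite_order_separation V E s" "snest W (separator s)"
  shows "W \<inter> (fst s - snd s) = {} \<or> W \<inter> (snd s - fst s) = {}"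
proof (rule ccontr)
  obtain A B where s: "s = (A, B)" by (cases s)
  assume "\<not> ?thesis"
  then obtain a b where ab: "a \<in> W" "a \<in> A" "a \<notin> B" "b \<in> W" "b \<in> B" "b \<notin> A" using s by auto
  then have "lk (A \<inter> B) a b" using assms(2) by (simp add: s snest_def separator_def)
  then have "b \<in> A - B" using lk_separation[of A B a b] assms(1) ab s by (simp add: fos_iff)
  then show False using ab by simp
qed

text \<open>A set nested with \<open>separator s\<close> meets at most one of the two sides of \<open>s\<close> outside the
  separator, hence avoids a full component at one of two opposite corners. So it does not cross
  both of them.\<close>

lemma corner_avoid:
  assumes s: "finite_order_separation V E s" "snest W (separator s)"
    and e: "eff (corner s t) p p'" "eff (corner (sep_reverse s) (sep_reverse t)) q q'"
    and rays: "p \<in> rays V E" "p' \<in> rays V E" "q \<in> rays V E" "q' \<in> rays V E"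
  shows "snest (separator (corner s t)) W \<or>
    snest (separator (corner (sep_reverse s) (sep_reverse t))) W"
proof -
  have *: "snest (separator (corner s t)) W"
    if "eff (corner s t) p p'" "p \<in> rays V E" "p' \<in> rays V E" "W \<inter> (fst s - snd s) = {}"
    for s t p p'
  proof -
    obtain A B C D where st: "s = (A, B)" "t = (C, D)" by (cases s, cases t)
    have e: "eff (A \<inter> C, B \<union> D) p p'" using that(1) by (simp add: corner_def st)
    have "ray_comp ((A \<inter> C) \<inter> (B \<union> D)) p \<inter> W = {}"
      using eff_comps(1)[OF e that(2,3)] that(4) st by auto
    then show ?thesis
      using full_avoid_snest[OF eff_full[OF e that(2,3)], of W]
      by (simp add: st corner_def separator_def)
  qed
  show ?thesis
    using snest_side[OF s] *[OF e(1) rays(1,2)] *[OF e(2) rays(3,4)] by auto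
qed

lemma corner_commute: "corner s t = corner t s"
  by (simp add: corner_def Int_commute Un_commute)

text \<open>What crosses one of two opposite corners crosses \<open>s\<close> or \<open>t\<close>, and what crosses both corners
  crosses both \<open>s\<close> and \<open>t\<close>. The inequality is strict because \<open>s\<close> crosses \<open>t\<close> but neither corner.\<close>

lemma crossing_corners:
  assumes rays: "w \<in> rays V E" "w' \<in> rays V E" "n \<in> rays V E" "n' \<in> rays V E"
      "p \<in> rays V E" "p' \<in> rays V E" "q \<in> rays V E" "q' \<in> rays V E"
    and st: "eff s w w'" "eff t n n'" "sep_order s = k"
    and cross: "\<not> snest (separator s) (separator t)"
    and e: "eff (corner s t) p p'" "eff (corner (sep_reverse s) (sep_reverse t)) q q'"
  shows "card (crossing k (separator (corner s t))) +
      card (crossing k (separator (corner (sep_reverse s) (sep_reverse t))))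
    < card (crossing k (separator s)) + card (crossing k (separator t))"
proof -
  let ?P = "separator (corner s t)"
  let ?Q = "separator (corner (sep_reverse s) (sep_reverse t))"
  let ?S = "separator s" let ?T = "separator t"
  let ?c = "crossing k"
  have tight: "tight ?S" "tight ?T" "tight ?P" "tight ?Q"
    using eff_tight rays st e by blast+
  then have fin: "finite (?c ?S)" "finite (?c ?T)" "finite (?c ?P)" "finite (?c ?Q)"
    by (auto simp: tight_def intro: finite_crossing_level)
  have sub: "?P \<subseteq> ?S \<union> ?T" "?Q \<subseteq> ?S \<union> ?T"
    using corner_separator[of s t] corner_separator[of "sep_reverse s" "sep_reverse t"] by auto
  have un: "?c X \<subseteq> ?c ?S \<union> ?c ?T" if X: "X \<subseteq> ?S \<union> ?T" for X
  proof (rule ccontr)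
    assume "\<not> ?thesis"
    then obtain W where W: "W \<in> level k" "\<not> snest W X" "snest W ?S" "snest W ?T"
      by (auto simp: crossing_def)
    have tW: "tight W" using level_tight[OF W(1)] by simp
    have SW: "snest ?S W" "snest ?T W" using snest_sym W(3,4) tight(1,2) by auto
    have "snest X W" using snest_union[OF tW tight(1,2) cross SW X] .
    then show False using snest_sym[of X W] tW W(2) by blast
  qed
  have int: "?c ?P \<inter> ?c ?Q \<subseteq> ?c ?S \<inter> ?c ?T"
  proof
    fix W assume "W \<in> ?c ?P \<inter> ?c ?Q"
    then have W: "W \<in> level k" "\<not> snest W ?P" "\<not> snest W ?Q" by (auto simp: crossing_def)
    have tW: "tight W" using level_tight[OF W(1)] by simp
    have no: "\<not> snest ?P W" "\<not> snest ?Q W" using snest_sym[OF _ tW] W(2,3) by auto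
    have "\<not> snest W ?S"
      using corner_avoid[OF eff_fos[OF st(1)] _ e rays(5-8)] no by blast
    moreover have "\<not> snest W ?T"
      using corner_avoid[OF eff_fos[OF st(2)] _ e[unfolded corner_commute[of s]
        corner_commute[of "sep_reverse s"]] rays(5-8)] no corner_commute by metis
    ultimately show "W \<in> ?c ?S \<inter> ?c ?T" using W(1) by (simp add: crossing_def)
  qed
  have S: "?S \<in> ?c ?T" using cross levelI[OF st(1) rays(1,2) st(3)] by (simp add: crossing_def)
  have "snest ?P ?S" "snest ?Q ?S"
    using corner_snest(1)[OF e(1) rays(5,6)] corner_snest(1)[OF e(2) rays(7,8)] by simp_all
  then have "?S \<notin> ?c ?P \<union> ?c ?Q" using snest_sym[OF _ tight(1)] by (auto simp: crossing_def)
  then have "?c ?P \<union> ?c ?Q \<subset> ?c ?S \<union> ?c ?T" using un[OF sub(1)] un[OF sub(2)] S by blast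
  then have "card (?c ?P \<union> ?c ?Q) < card (?c ?S \<union> ?c ?T)"
    using fin by (intro psubset_card_mono) auto
  moreover have "card (?c ?P \<inter> ?c ?Q) \<le> card (?c ?S \<inter> ?c ?T)"
    using fin int by (intro card_mono) auto
  ultimately show ?thesis
    using card_Un_Int[OF fin(1,2)] card_Un_Int[OF fin(3,4)] by linarith
qed

text \<open>If two separators of the same order cross, then one of them can be replaced by a corner with
  a smaller crossing number. The boolean indices orient the two separations and so enumerate
  the four corners; opposite corners have negated indices.\<close>

lemma uncross_equal:
  assumes rays: "w \<in> rays V E" "w' \<in> rays V E" "n \<in> rays V E" "n' \<in> rays V E"
    and s: "eff s w w'" "sep_order s = k" and t: "eff t n n'" "sep_order t = k"
    and cross: "\<not> snest (separator s) (separator t)"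
  shows "(\<exists>u. eff u w w' \<and> separator u \<subseteq> separator s \<union> separator t \<and>
      card (crossing k (separator u)) < card (crossing k (separator s))) \<or>
    (\<exists>u. eff u n n' \<and> separator u \<subseteq> separator s \<union> separator t \<and>
      card (crossing k (separator u)) < card (crossing k (separator t)))"
proof (rule ccontr)
  assume contr: "\<not> ?thesis"
  define orient :: "bool \<Rightarrow> 'a sep \<Rightarrow> 'a sep"
    where "orient b x = (if b then x else sep_reverse x)" for b x
  define c where "c a b = corner (orient a s) (orient b t)" for a b
  define f where "f a b = card (crossing k (separator (c a b)))" for a b
  define W where "W a b \<longleftrightarrow> sides (c a b) w w' \<or> sides (c a b) w' w" for a b
  define N where "N a b \<longleftrightarrow> sides (c a b) n n' \<or> sides (c a b) n' n" for a b
  let ?S = "card (crossing k (separator s))" and ?T = "card (crossing k (separator t))"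
  have orient_simps [simp]: "separator (orient b x) = separator x"
    "sep_order (orient b x) = sep_order x" "sep_reverse (orient b x) = orient (\<not> b) x" for b x
    by (auto simp: orient_def)
  have fos: "finite_order_separation V E (orient b s)" "finite_order_separation V E (orient b t)"
    for b using eff_fos[OF s(1)] eff_fos[OF t(1)] fos_reverse by (auto simp: orient_def)
  have sum: "sep_order (c a b) + sep_order (c (\<not> a) (\<not> b)) = 2 * k" for a b
    using corner_order[OF fos, of a b] s t by (simp add: c_def)
  have sub: "separator (c a b) \<subseteq> separator s \<union> separator t" for a b
    using corner_separator[of "orient a s" "orient b t"] by (simp add: c_def)
  have ge: "k \<le> sep_order (c a b)" if "W a b \<or> N a b" for a b
    using that eff_le[OF s(1), of "c a b"] eff_le[OF eff_reverse[OF s(1)], of "c a b"]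
      eff_le[OF t(1), of "c a b"] eff_le[OF eff_reverse[OF t(1)], of "c a b"] s(2) t(2)
    unfolding W_def N_def by auto
  have contrW: "?S \<le> card (crossing k (separator u))"
    if "eff u w w'" "separator u \<subseteq> separator s \<union> separator t" for u
    using that contr not_less by blast
  have contrN: "?T \<le> card (crossing k (separator u))"
    if "eff u n n'" "separator u \<subseteq> separator s \<union> separator t" for u
    using that contr not_less by blast
  \<comment> \<open>If both of two opposite corners distinguish one of the pairs, then both have order
    exactly \<open>k\<close>, so each of them competes with \<open>s\<close> or \<open>t\<close> for the least crossing number.\<close>
  have opp: "f a b + f (\<not> a) (\<not> b) < ?S + ?T \<and> (W a b \<longrightarrow> ?S \<le> f a b) \<and> (N a b \<longrightarrow> ?T \<le> f a b)
      \<and> (W (\<not> a) (\<not> b) \<longrightarrow> ?S \<le> f (\<not> a) (\<not> b)) \<and> (N (\<not> a) (\<not> b) \<longrightarrow> ?T \<le> f (\<not> a) (\<not> b))"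
    if h: "W a b \<or> N a b" "W (\<not> a) (\<not> b) \<or> N (\<not> a) (\<not> b)" for a b
  proof -
    have k: "sep_order (c a b) = k" "sep_order (c (\<not> a) (\<not> b)) = k"
      using ge[OF h(1)] ge[OF h(2)] sum[of a b] by auto
    have effW: "eff (c a b) w w' \<or> eff (c a b) w' w" if "W a b" "sep_order (c a b) = k" for a b
      using that eff_of_le[OF s(1), of "c a b"] eff_of_le[OF eff_reverse[OF s(1)], of "c a b"] s(2)
      unfolding W_def by auto
    have effN: "eff (c a b) n n' \<or> eff (c a b) n' n" if "N a b" "sep_order (c a b) = k" for a b
      using that eff_of_le[OF t(1), of "c a b"] eff_of_le[OF eff_reverse[OF t(1)], of "c a b"] t(2)
      unfolding N_def by auto
    have minW: "?S \<le> f a b" if h: "W a b" "sep_order (c a b) = k" for a b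
    proof -
      obtain u where "eff u w w'" "separator u = separator (c a b)"
        using effW[OF h] eff_reverse[of "c a b" w' w] separator_reverse[of "c a b"] by blast
      then show ?thesis using contrW[of u] sub[of a b] by (simp add: f_def)
    qed
    have minN: "?T \<le> f a b" if h: "N a b" "sep_order (c a b) = k" for a b
    proof -
      obtain u where "eff u n n'" "separator u = separator (c a b)"
        using effN[OF h] eff_reverse[of "c a b" n' n] separator_reverse[of "c a b"] by blast
      then show ?thesis using contrN[of u] sub[of a b] by (simp add: f_def)
    qed
    obtain p p' where p: "p \<in> rays V E" "p' \<in> rays V E" "eff (c a b) p p'"
      using h(1) effW[OF _ k(1)] effN[OF _ k(1)] rays by blast
    obtain q q' where q: "q \<in> rays V E" "q' \<in> rays V E" "eff (c (\<not> a) (\<not> b)) q q'"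
      using h(2) effW[OF _ k(2)] effN[OF _ k(2)] rays by blast
    obtain r1 r1' where r1: "r1 \<in> rays V E" "r1' \<in> rays V E" "eff (orient a s) r1 r1'"
      using s(1) eff_reverse[OF s(1)] rays by (cases a) (auto simp: orient_def)
    obtain r2 r2' where r2: "r2 \<in> rays V E" "r2' \<in> rays V E" "eff (orient b t) r2 r2'"
      using t(1) eff_reverse[OF t(1)] rays by (cases b) (auto simp: orient_def)
    have "f a b + f (\<not> a) (\<not> b) < ?S + ?T"
      using crossing_corners[OF r1(1,2) r2(1,2) p(1,2) q(1,2) r1(3) r2(3), of k] s(2) cross p(3) q(3)
      by (simp add: c_def f_def)
    then show ?thesis using minW[OF _ k(1)] minN[OF _ k(1)] minW[OF _ k(2)] minN[OF _ k(2)] by simp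
  qed
  have side: "\<exists>b. tail_in r (fst (orient b x))"
    if "r \<in> rays V E" "finite_order_separation V E x" for r x
    using tail_cases_sep[OF that] by (metis (full_types) orient_def reverse_simps(2))
  obtain x where x: "tail_in w (fst (orient x t))" using side rays eff_fos[OF t(1)] by blast
  obtain x' where x': "tail_in w' (fst (orient x' t))" using side rays eff_fos[OF t(1)] by blast
  obtain y where y: "tail_in n (fst (orient y s))" using side rays eff_fos[OF s(1)] by blast
  obtain y' where y': "tail_in n' (fst (orient y' s))" using side rays eff_fos[OF s(1)] by blast
  \<comment> \<open>Each of the four rays makes the corner that contains it distinguish its pair. For every
    position of the rays, this contradicts the crossing numbers of opposite corners.\<close>
  have "W True x" "W False x'" "N y True" "N y' False"
    unfolding W_def N_def c_def
    using corner_sides[OF fos(1)[of True] fos(2)[of x], of w w']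
      corner_sides[OF fos(1)[of False] fos(2)[of x'], of w' w]
      corner_sides[OF fos(1)[of y] fos(2)[of True], of n n']
      corner_sides[OF fos(1)[of y'] fos(2)[of False], of n' n]
      x x' y y' eff_tails[OF s(1)] eff_tails[OF t(1)]
    by (simp_all add: orient_def)
  then show False
    using opp[of True True] opp[of True False]
    by (cases x; cases x'; cases y; cases y') auto
qed

section \<open>A nested set of separators\<close>

text \<open>Among the efficient separators of order \<open>k\<close> for two given rays that are nested with all
  elements of \<open>N\<close>, take those that cross the fewest efficient separators of order \<open>k\<close>.\<close>

definition least_crossing :: "nat \<Rightarrow> 'a set set \<Rightarrow> 'a set set" where
  "least_crossing k N = {X. \<exists>s. \<exists>r\<in>rays V E. \<exists>r'\<in>rays V E. eff s r r' \<and> sep_order s = k \<and>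
    X = separator s \<and> (\<forall>Y\<in>N. snest X Y) \<and>
    (\<forall>t. eff t r r' \<longrightarrow> (\<forall>Y\<in>N. snest (separator t) Y) \<longrightarrow>
      card (crossing k X) \<le> card (crossing k (separator t)))}"

text \<open>The separators chosen for orders less than \<open>k\<close>.\<close>

primrec separators :: "nat \<Rightarrow> 'a set set" where
  "separators 0 = {}"
| "separators (Suc k) = separators k \<union> least_crossing k (separators k)"

lemma separators_level: "X \<in> separators k \<Longrightarrow> \<exists>j<k. X \<in> level j"
proof (induction k)
  case (Suc k)
  have "least_crossing k (separators k) \<subseteq> level k"
    unfolding least_crossing_def level_def by blast
  then show ?case using Suc.IH Suc.prems by (auto simp: less_Suc_eq)
qed simp

lemma separators_tight: "X \<in> separators k \<Longrightarrow> tight X"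
  using separators_level level_tight by blast

text \<open>An efficient separation whose separator crosses the fewest elements of \<open>N\<close> crosses none of
  them: uncrossing it from one element creates no new crossings.\<close>

lemma eff_nested_exists:
  assumes N: "\<And>X. X \<in> N \<Longrightarrow> \<exists>j<k. X \<in> level j" "\<And>X Y. X \<in> N \<Longrightarrow> Y \<in> N \<Longrightarrow> snest X Y"
    and rays: "r \<in> rays V E" "r' \<in> rays V E" and s: "eff s r r'" "sep_order s = k"
  shows "\<exists>t. eff t r r' \<and> (\<forall>Y\<in>N. snest (separator t) Y)"
proof -
  let ?c = "\<lambda>t. {Y\<in>N. \<not> snest Y (separator t)}"
  obtain t where t: "eff t r r'" and
    min: "\<And>u. eff u r r' \<Longrightarrow> card (?c t) \<le> card (?c u)"
    using ex_has_least_nat[of "\<lambda>t. eff t r r'" s "\<lambda>t. card (?c t)"] s(1) by blast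
  have tight: "tight (separator u)" if "eff u r r'" for u using eff_tight[OF that rays] .
  have "?c t \<subseteq> (\<Union>j<k. crossing j (separator t))" using N(1) by (auto simp: crossing_def)
  moreover have "finite (separator t)" using tight[OF t] by (simp add: tight_def)
  ultimately have fin: "finite (?c t)"
    using finite_subset finite_UN_I[OF finite_lessThan] finite_crossing_level by metis
  have "?c t = {}"
  proof (rule ccontr)
    assume "?c t \<noteq> {}"
    then obtain X where X: "X \<in> N" "\<not> snest X (separator t)" by blast
    obtain j where j: "j < k" "X \<in> level j" using N(1)[OF X(1)] by blast
    obtain q w w' where q: "eff q w w'" "sep_order q = j" "X = separator q"
      "w \<in> rays V E" "w' \<in> rays V E"
      using j(2) unfolding level_def by blast
    have "sep_order q < sep_order t" using q(2) j(1) eff_order_eq[OF t s(1)] s(2) by simp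
    from uncross_lower[OF q(4,5) rays q(1) t this] obtain u
      where u: "eff u r r'" "separator u \<subseteq> X \<union> separator t" "snest (separator u) X"
      using q(3) by blast
    have tX: "tight X" using level_tight[OF j(2)] by simp
    have "snest Y (separator u)" if Y: "Y \<in> N" "snest Y (separator t)" for Y
    proof -
      have tY: "tight Y" using N(1)[OF Y(1)] level_tight by blast
      have "snest (separator u) Y"
        using snest_union[OF tY tX tight[OF t] X(2) N(2)[OF X(1) Y(1)]
          snest_sym[OF Y(2) tight[OF t]] u(2)] .
      then show ?thesis using tY by (rule snest_sym)
    qed
    moreover have "snest X (separator u)" using snest_sym[OF u(3) tX] .
    ultimately have "?c u \<subset> ?c t" using X by blast
    then have "card (?c u) < card (?c t)" using psubset_card_mono[OF fin] by blast
    then show False using min[OF u(1)] by simp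
  qed
  then have "snest (separator t) Y" if "Y \<in> N" for Y
    using that snest_sym[OF _ tight[OF t]] snest_sym[of Y "separator t"] by blast
  then show ?thesis using t by blast
qed

lemma least_crossing_nested:
  assumes N: "\<And>X. X \<in> N \<Longrightarrow> tight X"
    and X: "X \<in> least_crossing k N" and Y: "Y \<in> least_crossing k N"
  shows "snest X Y"
proof (rule ccontr)
  assume cross: "\<not> snest X Y"
  obtain s w w' where s: "eff s w w'" "sep_order s = k" "w \<in> rays V E" "w' \<in> rays V E"
      "X = separator s" "\<forall>Z\<in>N. snest X Z"
    and min_s: "\<And>u. eff u w w' \<Longrightarrow> \<forall>Z\<in>N. snest (separator u) Z \<Longrightarrow>
      card (crossing k X) \<le> card (crossing k (separator u))"
    using X unfolding least_crossing_def by blast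
  obtain t n n' where t: "eff t n n'" "sep_order t = k" "n \<in> rays V E" "n' \<in> rays V E"
      "Y = separator t" "\<forall>Z\<in>N. snest Y Z"
    and min_t: "\<And>u. eff u n n' \<Longrightarrow> \<forall>Z\<in>N. snest (separator u) Z \<Longrightarrow>
      card (crossing k Y) \<le> card (crossing k (separator u))"
    using Y unfolding least_crossing_def by blast
  have tight: "tight X" "tight Y" using eff_tight[OF s(1,3,4)] eff_tight[OF t(1,3,4)] s(5) t(5) by auto
  have nest: "\<forall>Z\<in>N. snest U Z" if "U \<subseteq> X \<union> Y" for U
    using snest_union[OF N tight cross _ _ that] s(6) t(6) by blast
  show False
    using uncross_equal[OF s(3,4) t(3,4) s(1,2) t(1,2)] cross nest min_s min_t s(5) t(5)
    by (metis leD)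
qed

lemma separators_nested: "X \<in> separators k \<Longrightarrow> Y \<in> separators k \<Longrightarrow> snest X Y"
proof (induction k arbitrary: X Y)
  case (Suc k)
  have new: "snest X Y" if "X \<in> least_crossing k (separators k)" "Y \<in> separators k" for X Y
    using that unfolding least_crossing_def by blast
  have "snest Y X" if "X \<in> least_crossing k (separators k)" "Y \<in> separators k" for X Y
    using snest_sym[OF new[OF that] separators_tight[OF that(2)]] .
  moreover have "snest X Y"
    if "X \<in> least_crossing k (separators k)" "Y \<in> least_crossing k (separators k)" for X Y
    using least_crossing_nested[OF separators_tight that] .
  ultimately show ?case using Suc new by auto
qed simp

lemma separators_efficient:
  assumes rays: "r \<in> rays V E" "r' \<in> rays V E" and s: "eff s r r'"
  shows "\<exists>t. eff t r r' \<and> separator t \<in> separators (Suc (sep_order s))"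
proof -
  let ?N = "separators (sep_order s)" and ?k = "sep_order s"
  let ?P = "\<lambda>t. eff t r r' \<and> (\<forall>Y\<in>?N. snest (separator t) Y)"
  have "\<exists>t. ?P t"
    using separators_level separators_nested by (rule eff_nested_exists[OF _ _ rays s refl])
  then obtain t where t: "?P t" and
    min: "\<And>u. ?P u \<Longrightarrow> card (crossing ?k (separator t)) \<le> card (crossing ?k (separator u))"
    using ex_has_least_nat[of ?P _ "\<lambda>t. card (crossing ?k (separator t))"] by metis
  have "sep_order t = ?k" using eff_order_eq[of t r r' s] t s by simp
  then have "separator t \<in> least_crossing ?k ?N"
    using t min rays unfolding least_crossing_def by blast
  then have "separator t \<in> separators (Suc ?k)" by simp
  then show ?thesis using t by blast
qed

lemma separators_mono: "j \<le> k \<Longrightarrow> separators j \<subseteq> separators k"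
  by (induction k rule: dec_induct) auto

lemma nested_separators:
  "\<exists>M. (\<forall>X\<in>M. \<forall>Y\<in>M. snest X Y) \<and>
    (\<forall>r\<in>rays V E. \<forall>r'\<in>rays V E. (\<exists>s. sides s r r') \<longrightarrow> (\<exists>s. eff s r r' \<and> separator s \<in> M))"
proof (intro exI[of _ "\<Union>k. separators k"] conjI ballI impI)
  fix X Y assume "X \<in> (\<Union>k. separators k)" "Y \<in> (\<Union>k. separators k)"
  then obtain i j where "X \<in> separators i" "Y \<in> separators j" by blast
  then show "snest X Y"
    using separators_nested[of X "max i j" Y] separators_mono[of i "max i j"]
      separators_mono[of j "max i j"] by auto
next
  fix r r' assume rays: "r \<in> rays V E" "r' \<in> rays V E" and "\<exists>s. sides s r r'"
  then obtain s where "eff s r r'" using eff_exists by metis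
  from separators_efficient[OF rays this] obtain t
    where "eff t r r'" "separator t \<in> separators (Suc (sep_order s))" by metis
  then show "\<exists>s. eff s r r' \<and> separator s \<in> (\<Union>k. separators k)" by blast
qed

end

section \<open>From nested separators to nested separations\<close>

context graph begin

text \<open>The two rays are not distinguished by any separation of order less than \<open>k\<close>.\<close>

definition same :: "nat \<Rightarrow> (nat \<Rightarrow> 'a) \<Rightarrow> (nat \<Rightarrow> 'a) \<Rightarrow> bool" where
  "same k r r' \<longleftrightarrow> (\<forall>s. sides s r r' \<longrightarrow> k \<le> sep_order s)"

lemma same_le: "same k r r' \<Longrightarrow> sides s r r' \<Longrightarrow> k \<le> sep_order s"
  unfolding same_def by blast

lemma same_refl:
  assumes "r \<in> rays V E" shows "same k r r"
proof -
  have "\<not> sides s r r" for s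
    using tail_not_both[OF assms, of "fst s" "snd s"] by (auto simp: sides_def)
  then show ?thesis unfolding same_def by blast
qed

lemma same_sym: "same k r r' \<Longrightarrow> same k r' r"
  unfolding same_def using sides_reverse sep_order_reverse by metis

lemma same_trans:
  assumes "same k r p" "same k p q" "p \<in> rays V E" shows "same k r q"
  unfolding same_def
proof (intro allI impI)
  fix s assume s: "sides s r q"
  then have "tail_in p (fst s) \<or> tail_in p (snd s)"
    using tail_cases_sep[OF assms(3)] by (simp add: sides_def)
  then have "sides s p q \<or> sides s r p" using s by (auto simp: sides_def)
  then show "k \<le> sep_order s" using same_le[OF assms(1), of s] same_le[OF assms(2), of s] by blast
qed

lemma same_tail:
  assumes "same k r p" "p \<in> rays V E" "finite_order_separation V E s" "sep_order s < k"
    "tail_in r (fst s)"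
  shows "tail_in p (fst s)"
  using tail_cases_sep[OF assms(2,3)] same_le[OF assms(1), of s] assms(3-5)
  by (auto simp: sides_def)

text \<open>A representative of the class of \<open>r\<close> with respect to \<^term>\<open>same k\<close>.\<close>

definition rep :: "nat \<Rightarrow> (nat \<Rightarrow> 'a) \<Rightarrow> nat \<Rightarrow> 'a" where
  "rep k r = (SOME p. p \<in> rays V E \<and> same k r p)"

lemma rep:
  assumes "r \<in> rays V E" shows "rep k r \<in> rays V E" "same k r (rep k r)"
proof -
  have "r \<in> rays V E \<and> same k r r" using assms same_refl by blast
  then have "rep k r \<in> rays V E \<and> same k r (rep k r)" unfolding rep_def by (rule someI[where P = "\<lambda>p. p \<in> rays V E \<and> same k r p"])
  then show "rep k r \<in> rays V E" "same k r (rep k r)" by auto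
qed

lemma rep_eq:
  assumes "same k r r'" "r \<in> rays V E" "r' \<in> rays V E" shows "rep k r = rep k r'"
proof -
  have "same k r p \<longleftrightarrow> same k r' p" for p
    using same_trans[OF same_sym[OF assms(1)] _ assms(2), of p] same_trans[OF assms(1) _ assms(3), of p]
    by blast
  then show ?thesis unfolding rep_def by simp
qed

lemma nested_reverse [simp]:
  "nested (sep_reverse s) t \<longleftrightarrow> nested s t" "nested s (sep_reverse t) \<longleftrightarrow> nested s t"
  by (auto simp: nested_def)

end

text \<open>A nested set of separators that contains an efficient one for any two rays of different ends.\<close>

locale nested_separators = graph +
  fixes M :: "'a set set"
  assumes M_nested: "\<And>X Y. X \<in> M \<Longrightarrow> Y \<in> M \<Longrightarrow> snest X Y"
    and M_eff: "\<And>r r' s. r \<in> rays V E \<Longrightarrow> r' \<in> rays V E \<Longrightarrow> sides s r r' \<Longrightarrow>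
      \<exists>t. eff t r r' \<and> separator t \<in> M"

text \<open>The induction hypothesis of the recursion on the order: \<open>N\<close> is a nested set of separations of
  order less than \<open>k\<close>, with separators in \<open>M\<close>, that efficiently distinguishes all ends that can be
  distinguished by order less than \<open>k\<close>.\<close>

locale lower_separations = nested_separators +
  fixes k :: nat and N :: "'a sep set"
  assumes N_M: "\<And>s. s \<in> N \<Longrightarrow> separator s \<in> M"
    and N_order: "\<And>s. s \<in> N \<Longrightarrow> sep_order s < k"
    and N_eff: "\<And>s. s \<in> N \<Longrightarrow> \<exists>p\<in>rays V E. \<exists>q\<in>rays V E. eff s p q"
    and N_nested: "\<And>s t. s \<in> N \<Longrightarrow> t \<in> N \<Longrightarrow> nested s t"
    and N_complete: "\<And>r r' s. r \<in> rays V E \<Longrightarrow> r' \<in> rays V E \<Longrightarrow> sides s r r' \<Longrightarrow>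
      sep_order s < k \<Longrightarrow> \<exists>t\<in>N. eff t r r' \<or> eff t r' r"
begin

text \<open>The separations in \<open>N\<close>, each oriented such that its first side contains a tail of \<open>r\<close>. The
  strict second side \<open>B - A\<close> is called the small side of \<open>(A, B)\<close>.\<close>

definition oriented :: "(nat \<Rightarrow> 'a) \<Rightarrow> 'a sep set" where
  "oriented r = {s. (s \<in> N \<or> sep_reverse s \<in> N) \<and> tail_in r (fst s)}"

lemma orientedD:
  assumes "(A, B) \<in> oriented r"
  shows "finite_order_separation V E (A, B)" "A \<inter> B \<in> M" "sep_order (A, B) < k" "tail_in r A"
    "\<exists>D. full (A \<inter> B) D \<and> D \<subseteq> B - A"
proof -
  let ?s = "(A, B)"
  have s: "?s \<in> N \<or> sep_reverse ?s \<in> N" and tl: "tail_in r A"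
    using assms by (auto simp: oriented_def)
  obtain p q where pq: "p \<in> rays V E" "q \<in> rays V E" and e: "eff ?s p q"
    using s
  proof
    assume "?s \<in> N"
    then show ?thesis using N_eff that by metis
  next
    assume "sep_reverse ?s \<in> N"
    then obtain p q where "p \<in> rays V E" "q \<in> rays V E" "eff (sep_reverse ?s) p q"
      using N_eff by metis
    then show ?thesis using eff_reverse[of "sep_reverse ?s" p q] that by simp
  qed
  show "finite_order_separation V E ?s" using eff_fos[OF e] .
  have "separator ?s \<in> M" using s N_M[of ?s] N_M[of "sep_reverse ?s"] by auto
  then show "A \<inter> B \<in> M" by (simp add: separator_def)
  show "sep_order ?s < k" using s N_order[of ?s] N_order[of "sep_reverse ?s"] by auto
  show "tail_in r A" by (rule tl)
  show "\<exists>D. full (A \<inter> B) D \<and> D \<subseteq> B - A"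
    using eff_full'[OF e pq] eff_comps(2)[OF e pq] by blast
qed

lemma oriented_nested: "s \<in> oriented r \<Longrightarrow> t \<in> oriented r' \<Longrightarrow> nested s t"
  using N_nested[of s t] N_nested[of "sep_reverse s" t] N_nested[of s "sep_reverse t"]
    N_nested[of "sep_reverse s" "sep_reverse t"]
  by (auto simp: oriented_def)

text \<open>The small sides of the separations in \<open>N\<close> are disjoint or comparable.\<close>

lemma oriented_cases:
  assumes r: "r \<in> rays V E" and s: "(A, B) \<in> oriented r" and t: "(C, D) \<in> oriented r"
    and meet: "(B - A) \<inter> (D - C) \<noteq> {}"
  shows "C \<subseteq> A \<and> B \<subseteq> D \<or> A \<subseteq> C \<and> D \<subseteq> B"
proof -
  have "\<not> (A \<subseteq> D \<and> C \<subseteq> B)"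
  proof
    assume "A \<subseteq> D \<and> C \<subseteq> B"
    then have "tail_in r B" using orientedD(4)[OF t] tail_in_mono by blast
    then show False using tail_not_both[OF r orientedD(1,4)[OF s]] by blast
  qed
  moreover have "\<not> (B \<subseteq> C \<and> D \<subseteq> A)" using meet by blast
  ultimately show ?thesis
    using oriented_nested[OF s t] by (auto simp: nested_def sep_le_def sep_reverse_def)
qed

text \<open>The orientation depends only on the class of \<open>r\<close>.\<close>

lemma oriented_same:
  assumes "same k r p" "r \<in> rays V E" "p \<in> rays V E" shows "oriented r = oriented p"
proof -
  have "s \<in> oriented p" if "s \<in> oriented r" "same k r p" "p \<in> rays V E" for s r p
  proof -
    obtain A B where s: "s = (A, B)" by (cases s)
    show ?thesis
      using that same_tail[OF that(2,3), of s] orientedD(1,3)[of A B r] s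
      by (auto simp: oriented_def)
  qed
  then show ?thesis using assms same_sym[OF assms(1)] by blast
qed

text \<open>The set \<open>X\<close> in \<open>M\<close> has order \<open>k\<close> and separates the rays \<open>r\<close> and \<open>p\<close> efficiently: these are not
  distinguished by order less than \<open>k\<close>, and they have tails in different full components. In
  the application \<open>p\<close> is the representative of the class of \<open>r\<close>.\<close>

definition cut :: "'a set \<Rightarrow> (nat \<Rightarrow> 'a) \<Rightarrow> (nat \<Rightarrow> 'a) \<Rightarrow> bool" where
  "cut X r p \<longleftrightarrow> X \<in> M \<and> finite X \<and> X \<subseteq> V \<and> card X = k \<and> r \<in> rays V E \<and> p \<in> rays V E \<and> same k r p \<and>
    full X (ray_comp X r) \<and> full X (ray_comp X p) \<and> ray_comp X r \<inter> ray_comp X p = {}"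

lemma cut_eff:
  assumes "eff s p r" "separator s \<in> M" "sep_order s = k" "r \<in> rays V E" "p \<in> rays V E"
  shows "cut (separator s) r p"
proof -
  obtain A B where s: "s = (A, B)" by (cases s)
  note e = assms(1)[unfolded s]
  have "same k p r" using eff_le[OF assms(1)] assms(3) unfolding same_def by blast
  moreover have "finite (A \<inter> B)" "A \<inter> B \<subseteq> V"
    using eff_fos[OF e] by (auto simp: fos_iff separation_def)
  moreover have "ray_comp (A \<inter> B) r \<inter> ray_comp (A \<inter> B) p = {}"
    using eff_comps[OF e assms(5,4)] by blast
  ultimately show ?thesis
    using assms(2-5) eff_full[OF e assms(5,4)] eff_full'[OF e assms(5,4)] same_sym
    unfolding cut_def s by (auto simp: separator_def sep_order_def)
qed

text \<open>The components of \<open>r\<close> and \<open>p\<close> are both full and one of them avoids the separator of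
  \<open>(A, B)\<close>; it lies in \<open>A\<close> with the ray, and so do its neighbours in \<open>X\<close>.\<close>

lemma separator_subset_side:
  assumes cut: "cut X r p" and AB: "(A, B) \<in> oriented r"
  shows "X \<subseteq> A"
proof
  fix x assume x: "x \<in> X"
  note c = cut[unfolded cut_def]
  have "snest (A \<inter> B) X" using M_nested orientedD(2)[OF AB] c by blast
  from snest_disjoint_full[OF this, of "ray_comp X r" "ray_comp X p"]
  obtain f where f: "f = r \<or> f = p" "ray_comp X f \<inter> (A \<inter> B) = {}" using c by blast
  have full: "full X (ray_comp X f)" and fr: "f \<in> rays V E" using f(1) c by auto
  have "tail_in f A"
    using f(1) orientedD(4)[OF AB] same_tail[of k r p "(A, B)"] orientedD(1,3)[OF AB] c by auto
  then have "ray_comp X f \<inter> A \<noteq> {}"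
    using tail_in_nonempty tail_in_Int[OF tail_in_ray_comp[OF fr, of X]] c by blast
  then obtain a where a: "a \<in> ray_comp X f" "a \<in> A" by blast
  show "x \<in> A"
  proof (cases "x \<in> A \<inter> B")
    case False
    then have "lk (A \<inter> B) a x" using full_avoid_lk[OF full f(2), of a x] a(1) x by blast
    then show ?thesis using lk_separation[of A B a x] a(2) orientedD(1)[OF AB] by (simp add: fos_iff)
  qed simp
qed

text \<open>A full component of \<open>G - X\<close> that meets the small side of a separation of smaller order
  also meets its separator, and hence contains it up to \<open>X\<close>.\<close>

lemma full_meets_side:
  assumes cut: "cut X r p" and AB: "(A, B) \<in> oriented r"
    and F: "full X F" "F \<inter> (B - A) \<noteq> {}"
  shows "A \<inter> B \<inter> F \<noteq> {}" "A \<inter> B \<subseteq> X \<union> F"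
proof -
  note c = cut[unfolded cut_def]
  have XA: "X \<subseteq> A" using separator_subset_side[OF cut AB] .
  have fos: "finite_order_separation V E (A, B)" using orientedD(1)[OF AB] .
  show meet: "A \<inter> B \<inter> F \<noteq> {}"
  proof
    assume no: "A \<inter> B \<inter> F = {}"
    have "card (A \<inter> B) < card X" using orientedD(3)[OF AB] c by (simp add: sep_order_def separator_def)
    then have "\<not> X \<subseteq> A \<inter> B" using card_mono[of "A \<inter> B" X] fos by (auto simp: fos_iff)
    then obtain x where x: "x \<in> X" "x \<notin> A \<inter> B" by blast
    obtain b where b: "b \<in> F" "b \<in> B" "b \<notin> A" using F(2) by blast
    have "lk (B \<inter> A) b x" using full_avoid_lk[OF F(1), of "B \<inter> A" b x] no b x by blast
    then have "x \<in> B - A" using lk_separation[of B A b x] fos_swap[OF fos] b by (simp add: fos_iff)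
    then show False using XA x by blast
  qed
  then obtain z where z: "z \<in> A \<inter> B" "z \<in> F" by blast
  have "snest (A \<inter> B) X" using M_nested orientedD(2)[OF AB] c by blast
  moreover have "z \<notin> X" using full_in[OF F(1) z(2)] by blast
  ultimately have "lk X z y" if "y \<in> A \<inter> B" "y \<notin> X" for y
    using z(1) that unfolding snest_def by blast
  then show "A \<inter> B \<subseteq> X \<union> F" using full_closed[OF F(1) z(2)] by blast
qed

text \<open>No small side meets two full components, so enlarging a component by the small sides that it
  meets does not reach another full component.\<close>

lemma side_meets_one:
  assumes "cut X r p" "(A, B) \<in> oriented r" "full X F" "full X F'" "F \<inter> F' = {}"
    "F \<inter> (B - A) \<noteq> {}"
  shows "F' \<inter> (B - A) = {}"
  using full_meets_side[OF assms(1,2,3,6)] full_meets_side[OF assms(1,2,4)] assms(5) full_disj[OF assms(4)]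
  by blast

text \<open>The component of \<open>r\<close>, enlarged by the small sides that it meets. This also decides
  where the components of \<open>G - X\<close> go that are not full, in a way that agrees with \<open>N\<close>.\<close>

definition big :: "'a set \<Rightarrow> (nat \<Rightarrow> 'a) \<Rightarrow> 'a set" where
  "big X r = ray_comp X r \<union>
    \<Union>{B - A | A B. (A, B) \<in> oriented r \<and> ray_comp X r \<inter> (B - A) \<noteq> {}}"

text \<open>The separation with separator \<open>X\<close> that has the enlarged component on its second side.\<close>

definition big_sep :: "'a set \<Rightarrow> (nat \<Rightarrow> 'a) \<Rightarrow> 'a sep" where
  "big_sep X r = (V - big X r, big X r \<union> X)"

lemma bigE:
  assumes "x \<in> big X r"
  obtains "x \<in> ray_comp X r"
  | A B where "(A, B) \<in> oriented r" "ray_comp X r \<inter> (B - A) \<noteq> {}" "x \<in> B - A"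
  using assms unfolding big_def by blast

lemma comp_subset_big: "ray_comp X r \<subseteq> big X r"
  by (simp add: big_def)

lemma side_subset_big:
  "(A, B) \<in> oriented r \<Longrightarrow> ray_comp X r \<inter> (B - A) \<noteq> {} \<Longrightarrow> B - A \<subseteq> big X r"
  unfolding big_def by blast

lemma big_disj:
  assumes "cut X r p" shows "big X r \<inter> X = {}"
proof -
  have "x \<notin> X" if "x \<in> big X r" for x
    using that
  proof (cases rule: bigE)
    case 1
    then show ?thesis using full_disj[of X "ray_comp X r"] assms by (auto simp: cut_def)
  next
    case (2 A B)
    then show ?thesis using separator_subset_side[OF assms] by blast
  qed
  then show ?thesis by blast
qed

lemma big_subset:
  assumes "cut X r p" shows "big X r \<subseteq> V"
proof
  fix x assume "x \<in> big X r"
  then show "x \<in> V"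
  proof (cases rule: bigE)
    case 1
    then show ?thesis using full_in[of X "ray_comp X r"] assms by (auto simp: cut_def)
  next
    case (2 A B)
    then show ?thesis using orientedD(1)[OF 2(1)] by (auto simp: fos_iff separation_def)
  qed
qed

lemma big_closed:
  assumes cut: "cut X r p" and u: "u \<in> big X r" and e: "{u, w} \<in> E" "w \<notin> X"
  shows "w \<in> big X r"
  using u
proof (cases rule: bigE)
  case 1
  then show ?thesis
    using full_step[of X "ray_comp X r" u w] e cut comp_subset_big by (auto simp: cut_def)
next
  case (2 A B)
  have "w \<in> B"
    using separation_edge[of B A u w] separation_swap orientedD(1)[OF 2(1)] 2(3) e(1)
    by (auto simp: fos_iff)
  moreover have "A \<inter> B \<subseteq> X \<union> ray_comp X r"
    using full_meets_side(2)[OF cut 2(1) _ 2(2)] cut by (simp add: cut_def)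
  ultimately show ?thesis using side_subset_big[OF 2(1,2)] comp_subset_big e(2) by blast
qed

lemma big_separation:
  assumes cut: "cut X r p"
  shows "separation V E (big_sep X r)" "separator (big_sep X r) = X"
proof -
  note c = cut[unfolded cut_def]
  have sub: "big X r \<subseteq> V" "big X r \<inter> X = {}" using big_subset[OF cut] big_disj[OF cut] by auto
  have "{a, b} \<notin> E" if "a \<in> (V - big X r) - (big X r \<union> X)" "b \<in> (big X r \<union> X) - (V - big X r)" for a b
    using that big_closed[OF cut, of b a] edge_sym[of a b] c by blast
  moreover have "(V - big X r) \<union> (big X r \<union> X) = V" using sub c by blast
  ultimately show "separation V E (big_sep X r)" by (simp add: big_sep_def separation_def)
  show "separator (big_sep X r) = X" using sub c by (auto simp: big_sep_def separator_def)
qed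

lemma big_avoids_full:
  assumes cut: "cut X r p" and F: "full X F" "ray_comp X r \<inter> F = {}"
  shows "big X r \<inter> F = {}"
proof -
  have "x \<notin> F" if "x \<in> big X r" for x
    using that
  proof (cases rule: bigE)
    case 1
    then show ?thesis using F(2) by blast
  next
    case (2 A B)
    have "F \<inter> (B - A) = {}"
      using side_meets_one[OF cut 2(1) _ F(1,2) 2(2)] cut by (simp add: cut_def)
    then show ?thesis using 2(3) by blast
  qed
  then show ?thesis by blast
qed

text \<open>Every small side lies in the enlarged component or is disjoint from it. This gives
  nestedness, in a form that also determines which of its four cases occurs.\<close>

lemma big_sep_oriented:
  assumes cut: "cut X r p" and AB: "(A, B) \<in> oriented r"
  shows "B \<subseteq> V - big X r \<and> big X r \<union> X \<subseteq> A \<or> V - big X r \<subseteq> A \<and> B \<subseteq> big X r \<union> X"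
proof -
  have XA: "X \<subseteq> A" using separator_subset_side[OF cut AB] .
  have AV: "A \<union> B = V" using orientedD(1)[OF AB] by (simp add: fos_iff separation_def)
  have r: "r \<in> rays V E" and fullr: "full X (ray_comp X r)" using cut by (auto simp: cut_def)
  show ?thesis
  proof (cases "big X r \<inter> (B - A) = {}")
    case True
    \<comment> \<open>A vertex of \<open>A \<inter> B\<close> in the enlarged component would bring its neighbour in \<open>D\<close> along.\<close>
    obtain D where D: "full (A \<inter> B) D" "D \<subseteq> B - A" using orientedD(5)[OF AB] by blast
    have "z \<notin> big X r" if z: "z \<in> A \<inter> B" for z
    proof
      assume zb: "z \<in> big X r"
      obtain d where d: "d \<in> D" "{z, d} \<in> E" using full_nbr[OF D(1) z] by blast
      then have "d \<in> big X r" using big_closed[OF cut zb d(2)] D(2) XA by blast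
      then show False using d(1) D(2) True by blast
    qed
    then show ?thesis using True big_subset[OF cut] AV XA by blast
  next
    case False
    have "\<exists>A' B'. (A', B') \<in> oriented r \<and> ray_comp X r \<inter> (B' - A') \<noteq> {} \<and> B \<subseteq> B' \<and> A' \<subseteq> A"
    proof -
      obtain x where x: "x \<in> big X r" "x \<in> B - A" using False by blast
      from x(1) show ?thesis
      proof (cases rule: bigE)
        case 1
        then show ?thesis using AB x(2) by blast
      next
        case (2 A' B')
        have "A' \<subseteq> A \<and> B \<subseteq> B' \<or> A \<subseteq> A' \<and> B' \<subseteq> B"
          using oriented_cases[OF r AB 2(1)] x(2) 2(3) by blast
        then show ?thesis using 2 AB by blast
      qed
    qed
    then obtain A' B' where s: "(A', B') \<in> oriented r" "ray_comp X r \<inter> (B' - A') \<noteq> {}"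
      "B \<subseteq> B'" "A' \<subseteq> A" by blast
    have "B' - A' \<subseteq> big X r" using side_subset_big[OF s(1,2)] .
    moreover have "A' \<inter> B' \<subseteq> X \<union> ray_comp X r" using full_meets_side(2)[OF cut s(1) fullr s(2)] .
    ultimately have "B \<subseteq> big X r \<union> X" "V - big X r \<subseteq> A"
      using s(3,4) comp_subset_big[of X r] AV by blast+
    then show ?thesis by blast
  qed
qed

lemma big_sep_nested_lower:
  assumes cut: "cut X r p" and s: "s \<in> N" shows "nested (big_sep X r) s"
proof -
  have r: "r \<in> rays V E" using cut by (simp add: cut_def)
  have "finite_order_separation V E s" using N_eff[OF s] eff_fos by blast
  then have "s \<in> oriented r \<or> sep_reverse s \<in> oriented r"
    using tail_cases_sep[OF r, of s] s by (auto simp: oriented_def)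
  moreover have "nested (big_sep X r) t" if "t \<in> oriented r" for t
  proof -
    obtain A B where t: "t = (A, B)" by (cases t)
    then show ?thesis
      using big_sep_oriented[OF cut, of A B] that
      by (auto simp: nested_def big_sep_def sep_le_def sep_reverse_def)
  qed
  ultimately show ?thesis using nested_reverse(2) by blast
qed

text \<open>Two separations for rays in different classes are nested because \<open>N\<close> contains
  a separation between them.\<close>

lemma big_sep_nested_different:
  assumes cut: "cut X r p" "cut Y r' p'" and diff: "\<not> same k r r'"
  shows "nested (big_sep X r) (big_sep Y r')"
proof -
  have rays: "r \<in> rays V E" "r' \<in> rays V E" using cut by (auto simp: cut_def)
  obtain s where s: "sides s r r'" "sep_order s < k" using diff by (auto simp: same_def not_le)
  obtain t where t: "t \<in> N" "eff t r r' \<or> eff t r' r" using N_complete[OF rays s] by blast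
  obtain A B where AB: "(A, B) = (if eff t r r' then t else sep_reverse t)" by (metis surj_pair)
  have "(A, B) \<in> oriented r" "(B, A) \<in> oriented r'"
    using t eff_tails[of t r r'] eff_tails[of t r' r] AB
    by (auto simp: oriented_def sep_reverse_def split: if_splits prod.splits)
  then show ?thesis
    using big_sep_oriented[OF cut(1), of A B] big_sep_oriented[OF cut(2), of B A]
    unfolding nested_def big_sep_def sep_le_def sep_reverse_def split_conv by blast
qed

text \<open>If the two components are disjoint, each avoiding the separator of the other, then this also
  holds for the enlarged components: a small side meeting both would have its separator
  contained in the first one up to \<open>X\<close>, but meeting the second one.\<close>

lemma big_sep_nested_disjoint:
  assumes cut: "cut X r p" "cut Y r' p" and same: "same k r r'"
    and disj: "ray_comp X r \<inter> Y = {}" "ray_comp Y r' \<inter> X = {}" "ray_comp X r \<inter> ray_comp Y r' = {}"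
  shows "nested (big_sep X r) (big_sep Y r')"
proof -
  let ?C = "ray_comp X r" and ?D = "ray_comp Y r'"
  have rays: "r \<in> rays V E" "r' \<in> rays V E" and full: "full X ?C" "full Y ?D"
    using cut by (auto simp: cut_def)
  have or: "oriented r' = oriented r" using oriented_same[OF same rays] by simp
  have no: "?C \<inter> (B - A) = {} \<or> ?D \<inter> (B - A) = {}" if AB: "(A, B) \<in> oriented r" for A B
  proof (rule ccontr)
    assume "\<not> ?thesis"
    then have "A \<inter> B \<subseteq> X \<union> ?C" "A \<inter> B \<inter> ?D \<noteq> {}"
      using full_meets_side[OF cut(1) AB full(1)] full_meets_side[OF cut(2) _ full(2), of A B] AB or
      by auto
    then show False using disj by blast
  qed
  have "x \<notin> big Y r'" if x: "x \<in> big X r" for x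
  proof
    assume "x \<in> big Y r'"
    then show False
    proof (cases rule: bigE)
      case D: 1
      from x show False
      proof (cases rule: bigE)
        case 1
        then show False using D disj by blast
      next
        case (2 A B)
        then show False using D no by blast
      qed
    next
      case D: (2 A' B')
      from x show False
      proof (cases rule: bigE)
        case 1
        then show False using D no or by blast
      next
        case (2 A B)
        have "A' \<subseteq> A \<and> B \<subseteq> B' \<or> A \<subseteq> A' \<and> B' \<subseteq> B"
          using oriented_cases[OF rays(1) 2(1), of A' B'] D or 2(3) by blast
        then have "B - A \<subseteq> B' - A' \<or> B' - A' \<subseteq> B - A" by blast
        then show False
          using no[OF 2(1)] no[of A' B'] 2(2) D(1,2) or by blast
      qed
    qed
  qed
  then have bb: "big X r \<inter> big Y r' = {}" by blast
  have "x \<notin> Y" if "x \<in> big X r" for x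
    using that
  proof (cases rule: bigE)
    case 1
    then show ?thesis using disj by blast
  next
    case (2 A B)
    then show ?thesis using separator_subset_side[OF cut(2), of A B] or by blast
  qed
  moreover have "x \<notin> X" if "x \<in> big Y r'" for x
    using that
  proof (cases rule: bigE)
    case 1
    then show ?thesis using disj by blast
  next
    case (2 A B)
    then show ?thesis using separator_subset_side[OF cut(1), of A B] or by blast
  qed
  ultimately have "big X r \<union> X \<subseteq> V - big Y r'" "big Y r' \<union> Y \<subseteq> V - big X r"
    using bb big_subset[OF cut(1)] big_subset[OF cut(2)] cut by (auto simp: cut_def)
  then show ?thesis by (simp add: nested_def big_sep_def sep_le_def sep_reverse_def)
qed

text \<open>A full component of \<open>G - X\<close> that avoids \<open>Y\<close> lies, together with \<open>X - Y\<close>, in the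
  component of \<open>G - Y\<close> that meets \<open>X\<close>.\<close>

lemma comp_subset:
  assumes "full X C" "C \<inter> Y = {}" "full Y D" "D \<inter> X \<noteq> {}" "snest X Y"
  shows "C \<subseteq> D" "X - Y \<subseteq> D"
proof -
  obtain x where x: "x \<in> D" "x \<in> X" using assms(4) by blast
  then have xY: "x \<notin> Y" using full_in[OF assms(3)] by blast
  have "lk Y x c" if "c \<in> C \<union> (X - Y)" for c
    using full_avoid_lk[OF assms(1,2), of x c] that x xY by blast
  then show "C \<subseteq> D" "X - Y \<subseteq> D" using full_closed[OF assms(3) x(1)] by blast+
qed

lemma big_sep_nested_subset:
  assumes cut: "cut X r p" "cut Y r' p" and same: "same k r r'"
    and sub: "ray_comp X r \<subseteq> ray_comp Y r'" "X \<subseteq> Y \<union> ray_comp Y r'"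
  shows "nested (big_sep X r) (big_sep Y r')"
proof -
  have rays: "r \<in> rays V E" "r' \<in> rays V E" using cut by (auto simp: cut_def)
  have "oriented r' = oriented r" using oriented_same[OF same rays] by simp
  then have "big X r \<subseteq> big Y r'" using sub(1) unfolding big_def by blast
  then have "V - big Y r' \<subseteq> V - big X r" "big X r \<union> X \<subseteq> big Y r' \<union> Y"
    using sub(2) comp_subset_big[of Y r'] by blast+
  then show ?thesis by (simp add: nested_def big_sep_def sep_le_def sep_reverse_def)
qed

lemma nested_sym: "nested s t \<Longrightarrow> nested t s"
  by (auto simp: nested_def sep_le_def sep_reverse_def split: prod.splits)

text \<open>Let \<open>C\<close> and \<open>D\<close> be the two components that get enlarged. If \<open>C\<close> avoids \<open>Y\<close> or \<open>D\<close> avoids \<open>X\<close>, then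
  \<open>C\<close> and \<open>D\<close> are disjoint, equal or comparable. Otherwise \<open>Y\<close> lies in \<open>C\<close> up to \<open>X\<close>, and the
  component of the common representative \<open>p\<close> in \<open>G - X\<close>, which avoids \<open>Y\<close>, lies in \<open>D\<close>; but \<open>p\<close>
  has no tail in \<open>D\<close>.\<close>

lemma big_sep_nested_same:
  assumes cut: "cut X r p" "cut Y r' p"
  shows "nested (big_sep X r) (big_sep Y r')"
proof -
  let ?C = "ray_comp X r" and ?D = "ray_comp Y r'" and ?Cp = "ray_comp X p" and ?Dp = "ray_comp Y p"
  note c = cut(1)[unfolded cut_def] and d = cut(2)[unfolded cut_def]
  have full: "full X ?C" "full Y ?D" "full X ?Cp" "full Y ?Dp" using c d by auto
  have p: "p \<in> rays V E" using c by blast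
  have same: "same k r r'" using same_trans[of k r p r'] same_sym[of k r' p] c d by blast
  then have same': "same k r' r" by (rule same_sym)
  have XY: "snest X Y" "snest Y X" using M_nested c d by auto
  consider "?C \<inter> Y = {}" "?D \<inter> X = {}" | "?C \<inter> Y = {}" "?D \<inter> X \<noteq> {}"
    | "?C \<inter> Y \<noteq> {}" "?D \<inter> X = {}" | "?C \<inter> Y \<noteq> {}" "?D \<inter> X \<noteq> {}" by blast
  then show ?thesis
  proof cases
    case 1
    show ?thesis
    proof (cases "?C \<inter> ?D = {}")
      case True
      then show ?thesis using big_sep_nested_disjoint[OF cut same] 1 by blast
    next
      case False
      then obtain u where u: "u \<in> ?C" "u \<in> ?D" by blast
      have "X - Y \<subseteq> ?D"
        using full_avoid_lk[OF full(1) 1(1), of u] full_closed[OF full(2) u(2)] u(1) by blast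
      then have "X \<subseteq> Y" using 1(2) by blast
      then have "X = Y" using c d card_subset_eq[of Y X] by simp
      moreover from this have "?C = ?D" using full_eq[of X ?C ?D] full(1,2) False by simp
      moreover have "oriented r' = oriented r" using oriented_same[OF same] c d by simp
      ultimately have "big_sep X r = big_sep Y r'" by (simp add: big_sep_def big_def)
      then show ?thesis by (simp add: nested_def sep_le_def split: prod.splits)
    qed
  next
    case 2
    then show ?thesis
      using big_sep_nested_subset[OF cut same] comp_subset[OF full(1) 2(1) full(2) 2(2) XY(1)] by blast
  next
    case 3
    then show ?thesis
      using nested_sym[OF big_sep_nested_subset[OF cut(2,1) same']]
        comp_subset[OF full(2) 3(2) full(1) 3(1) XY(2)] by blast
  next
    case 4
    have "?Cp \<inter> Y = {}"
      using snest_disjoint_full[OF XY(2) full(1,3)] c 4(1) by blast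
    then have "?Cp \<subseteq> ?D" using comp_subset(1)[OF full(3) _ full(2) 4(2) XY(1)] by blast
    moreover have "?Cp \<inter> ?Dp \<noteq> {}"
      using tail_in_nonempty[OF tail_in_Int[OF tail_in_ray_comp[OF p] tail_in_ray_comp[OF p]]] c d
      by blast
    ultimately show ?thesis using d by blast
  qed
qed

text \<open>The separations of order \<open>k\<close>: for every separator in \<open>M\<close> that efficiently separates a ray from the
  representative of its class, the one that cuts off the enlarged component of the ray.\<close>

definition next_level :: "'a sep set" where
  "next_level = {big_sep (separator s) r | s r.
    separator s \<in> M \<and> sep_order s = k \<and> r \<in> rays V E \<and> eff s (rep k r) r}"

lemma next_levelE:
  assumes "u \<in> next_level"
  obtains X r where "u = big_sep X r" "cut X r (rep k r)"
  using assms cut_eff rep(1) unfolding next_level_def by blast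

lemma big_sep_sides:
  assumes cut: "cut X r p" and q: "q \<in> rays V E" "full X (ray_comp X q)"
    "ray_comp X r \<inter> ray_comp X q = {}"
  shows "sides (big_sep X r) q r"
proof -
  note c = cut[unfolded cut_def]
  have "tail_in q (V - big X r)"
    by (rule tail_in_mono[OF tail_in_ray_comp[OF q(1), of X]])
      (use c q big_avoids_full[OF cut q(2,3)] full_in[OF q(2)] in blast)+
  moreover have "tail_in r (big X r \<union> X)"
    by (rule tail_in_mono[OF tail_in_ray_comp[of r X]]) (use c comp_subset_big in blast)+
  moreover have "finite_order_separation V E (big_sep X r)"
    using big_separation[OF cut] c by (simp add: finite_order_separation_def)
  ultimately show ?thesis by (simp add: sides_def big_sep_def)
qed

lemma next_level_properties:
  assumes "u \<in> next_level"
  shows "separator u \<in> M" "sep_order u = k" "\<exists>p\<in>rays V E. \<exists>q\<in>rays V E. eff u p q"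
    "t \<in> N \<Longrightarrow> nested u t"
proof -
  obtain X r where u: "u = big_sep X r" and cut: "cut X r (rep k r)" by (rule next_levelE[OF assms])
  note c = cut[unfolded cut_def]
  have X: "separator u = X" using big_separation(2)[OF cut] u by simp
  show "separator u \<in> M" "sep_order u = k" using X c by (auto simp: sep_order_def)
  have "sides u (rep k r) r" using big_sep_sides[OF cut, of "rep k r"] c u by blast
  moreover have "same k (rep k r) r" using c same_sym by blast
  ultimately have "eff u (rep k r) r"
    using \<open>sep_order u = k\<close> unfolding eff_def same_def by blast
  then show "\<exists>p\<in>rays V E. \<exists>q\<in>rays V E. eff u p q" using c by blast
  show "nested u t" if "t \<in> N" using big_sep_nested_lower[OF cut that] u by simp
qed

lemma next_level_nested:
  assumes "u \<in> next_level" "v \<in> next_level" shows "nested u v"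
proof -
  obtain X r where u: "u = big_sep X r" and X: "cut X r (rep k r)" by (rule next_levelE[OF assms(1)])
  obtain Y r' where v: "v = big_sep Y r'" and Y: "cut Y r' (rep k r')" by (rule next_levelE[OF assms(2)])
  show ?thesis
  proof (cases "same k r r'")
    case True
    then have "rep k r = rep k r'" using rep_eq X Y by (simp add: cut_def)
    then show ?thesis using big_sep_nested_same X Y u v by simp
  next
    case False
    then show ?thesis using big_sep_nested_different[OF X Y] u v by blast
  qed
qed

text \<open>One of the two rays lies in another component of \<open>G - X\<close> than the representative of their
  common class; the enlarged component of this ray distinguishes the two.\<close>

lemma next_level_complete:
  assumes rays: "r \<in> rays V E" "r' \<in> rays V E" and s: "sides s r r'" "sep_order s = k"
    and same: "same k r r'"
  shows "\<exists>t\<in>next_level. eff t r r' \<or> eff t r' r"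
proof -
  obtain t where t: "eff t r r'" "separator t \<in> M" using M_eff[OF rays s(1)] by blast
  have tk: "sep_order t = k"
    using eff_le[OF t(1) s(1)] s(2) same_le[OF same eff_sides[OF t(1)]] by simp
  have main: "\<exists>u\<in>next_level. eff u a b"
    if t: "eff t a b" "separator t \<in> M" "sep_order t = k" and rays: "a \<in> rays V E" "b \<in> rays V E"
      and same: "same k a b" and tl: "tail_in (rep k b) (fst t)" for t a b
  proof -
    have "sides t (rep k b) b" using t(1) tl by (simp add: eff_def sides_def)
    moreover have "same k (rep k b) b" using rep(2)[OF rays(2)] by (rule same_sym)
    ultimately have e: "eff t (rep k b) b" using t(3) unfolding eff_def same_def by blast
    let ?X = "separator t" let ?u = "big_sep ?X b"
    have u: "?u \<in> next_level" using e t rays unfolding next_level_def by blast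
    have cut: "cut ?X b (rep k b)" using cut_eff[OF e t(2,3) rays(2) rep(1)[OF rays(2)]] .
    obtain A B where AB: "t = (A, B)" by (cases t)
    have "sides ?u a b"
      using big_sep_sides[OF cut rays(1)] eff_full[OF t(1)[unfolded AB] rays]
        eff_comps[OF t(1)[unfolded AB] rays] AB by (auto simp: separator_def)
    moreover have "sep_order ?u = k" using next_level_properties(2)[OF u] .
    ultimately have "eff ?u a b" using same unfolding eff_def same_def by blast
    then show ?thesis using u by blast
  qed
  have fos: "finite_order_separation V E t" using eff_fos[OF t(1)] .
  have rr: "rep k r = rep k r'" using rep_eq[OF same rays] .
  from tail_cases_sep[OF rep(1)[OF rays(2)] fos] show ?thesis
  proof
    assume "tail_in (rep k r') (fst t)"
    then show ?thesis using main[OF t tk rays same] by blast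
  next
    assume "tail_in (rep k r') (snd t)"
    then show ?thesis
      using main[OF eff_reverse[OF t(1)] _ _ rays(2,1) same_sym[OF same]] t tk rr by auto
  qed
qed

end

context nested_separators begin

text \<open>The separations chosen for orders less than \<open>k\<close>.\<close>

primrec separations :: "nat \<Rightarrow> 'a sep set" where
  "separations 0 = {}"
| "separations (Suc k) =
    separations k \<union> lower_separations.next_level V E M k (separations k)"

lemma separations_lower: "lower_separations V E M k (separations k)"
proof (induction k)
  case 0
  show ?case by unfold_locales auto
next
  case (Suc k)
  interpret L: lower_separations V E M k "separations k" by (rule Suc)
  show ?case
  proof
    fix s assume "s \<in> separations (Suc k)"
    then have s: "s \<in> separations k \<or> s \<in> L.next_level" by simp
    show "separator s \<in> M" using s L.N_M L.next_level_properties(1) by blast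
    show "sep_order s < Suc k"
      using s L.N_order L.next_level_properties(2) by (metis less_Suc_eq)
    show "\<exists>p\<in>rays V E. \<exists>q\<in>rays V E. eff s p q"
      using s L.N_eff L.next_level_properties(3) by metis
    fix t assume "t \<in> separations (Suc k)"
    then have t: "t \<in> separations k \<or> t \<in> L.next_level" by simp
    show "nested s t"
      using s t L.N_nested[of s t] L.next_level_properties(4)[of s t]
        L.next_level_properties(4)[of t s] L.next_level_nested[of s t] L.nested_sym[of t s]
      by blast
  next
    fix r r' s assume rays: "r \<in> rays V E" "r' \<in> rays V E" and s: "sides s r r'" "sep_order s < Suc k"
    show "\<exists>t\<in>separations (Suc k). eff t r r' \<or> eff t r' r"
    proof (cases "same k r r'")
      case True
      then have "sep_order s = k" using same_le[OF True s(1)] s(2) by simp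
      from L.next_level_complete[OF rays s(1) this True] show ?thesis by auto
    next
      case False
      then obtain u where "sides u r r'" "sep_order u < k" unfolding same_def not_le[symmetric] by blast
      from L.N_complete[OF rays this] show ?thesis by auto
    qed
  qed
qed

lemma separations_mono: "j \<le> k \<Longrightarrow> separations j \<subseteq> separations k"
  by (induction k rule: dec_induct) auto

lemma nested_separations:
  "\<exists>N. (\<forall>s\<in>N. finite_order_separation V E s) \<and> nested_set N \<and>
    (\<forall>r\<in>rays V E. \<forall>r'\<in>rays V E. \<forall>s. sides s r r' \<longrightarrow> (\<exists>t\<in>N. eff t r r' \<or> eff t r' r))"
proof (intro exI[of _ "\<Union>k. separations k"] conjI ballI allI impI)
  fix s assume "s \<in> (\<Union>k. separations k)"
  then obtain k where "s \<in> separations k" by blast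
  then show "finite_order_separation V E s"
    using lower_separations.N_eff[OF separations_lower] eff_fos by metis
next
  show "nested_set (\<Union>k. separations k)"
    unfolding nested_set_def
  proof (intro ballI)
    fix s t assume "s \<in> (\<Union>k. separations k)" "t \<in> (\<Union>k. separations k)"
    then obtain i j where "s \<in> separations i" "t \<in> separations j" by blast
    then have "s \<in> separations (max i j)" "t \<in> separations (max i j)"
      using separations_mono[of i "max i j"] separations_mono[of j "max i j"] by auto
    then show "nested s t" by (rule lower_separations.N_nested[OF separations_lower])
  qed
next
  fix r r' s assume "r \<in> rays V E" "r' \<in> rays V E" "sides s r r'"
  from lower_separations.N_complete[OF separations_lower this lessI]
  show "\<exists>t\<in>(\<Union>k. separations k). eff t r r' \<or> eff t r' r" by blast
qed

end

section \<open>Ends\<close>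

context graph begin

text \<open>A finite set that separates two rays is the separator of a separation distinguishing them,
  which has the component of one of the rays on one side.\<close>

lemma sides_of_separates:
  assumes rays: "r \<in> rays V E" "r' \<in> rays V E"
    and S: "finite S" "S \<subseteq> V" "separates V E S (range r) (range r')"
  shows "sides (S \<union> ray_comp S r, V - ray_comp S r) r r'"
proof -
  let ?C = "ray_comp S r"
  obtain n where n: "?C = {w. lk S (r n) w}" using ray_comp_eq[OF rays(1) S(1)] by blast
  have "r' m \<notin> ?C" for m using S(3) n by (auto simp: separates_def)
  moreover have "r' m \<in> V" for m using rays(2) by (auto simp: rays_def)
  ultimately have "tail_in r' (V - ?C)" by (simp add: tail_in_def)
  moreover have "tail_in r (S \<union> ?C)"
    by (rule tail_in_mono[OF tail_in_ray_comp[OF rays(1) S(1)]]) blast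
  moreover have CV: "?C \<subseteq> V - S" using ray_comp_in[OF rays(1) S(1)] by blast
  moreover have "separation V E (S \<union> ?C, V - ?C)"
    using CV S(2) ray_comp_closed[OF rays(1) S(1)] by (auto simp: separation_def)
  moreover have "(S \<union> ?C) \<inter> (V - ?C) = S" using CV S(2) by blast
  ultimately show ?thesis using S(1) by (simp add: sides_def fos_iff)
qed

lemma ray_equiv_iff:
  "(r, r') \<in> ray_equiv V E \<longleftrightarrow> r \<in> rays V E \<and> r' \<in> rays V E \<and> (\<forall>s. \<not> sides s r r')"
proof -
  have "\<exists>S. S \<subseteq> V \<and> finite S \<and> separates V E S (range r) (range r')"
    if rays: "r \<in> rays V E" "r' \<in> rays V E" and s: "sides s r r'" for s
  proof -
    obtain A B where AB: "s = (A, B)" by (cases s)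
    have fos: "separation V E (A, B)" "finite (A \<inter> B)" and tl: "tail_in r A" "tail_in r' B"
      using s by (auto simp: AB sides_def fos_iff)
    have fin: "finite (range q - C)" if tail: "tail_in q C" for q C
    proof -
      obtain n where "\<forall>m\<ge>n. q m \<in> C" using tail by (auto simp: tail_in_def eventually_sequentially)
      then have "m < n" if "q m \<notin> C" for m using that leI by blast
      then have "range q - C \<subseteq> q ` {..<n}" by auto
      then show ?thesis using finite_subset by blast
    qed
    \<comment> \<open>The rays may start on the wrong sides, so these finitely many vertices are deleted too.\<close>
    let ?S = "A \<inter> B \<union> (range r - A) \<union> (range r' - B)"
    have "\<not> lk ?S x y" if "x \<in> range r" "y \<in> range r'" for x y
    proof
      assume xy: "lk ?S x y"
      then have "x \<in> A" "y \<in> B" using that lk_in[OF xy] by auto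
      moreover have "lk (A \<inter> B) x y" using lk_mono[OF xy] by blast
      ultimately show False using lk_separation[OF fos(1)] by blast
    qed
    then have "separates V E ?S (range r) (range r')" by (auto simp: separates_def)
    moreover have "?S \<subseteq> V" using rays fos(1) by (auto simp: rays_def separation_def)
    ultimately show ?thesis using fos(2) fin[OF tl(1)] fin[OF tl(2)] by (intro exI[of _ ?S]) simp
  qed
  then show ?thesis using sides_of_separates[of r r'] unfolding ray_equiv_def by blast
qed

lemma equiv_ray_equiv: "equiv (rays V E) (ray_equiv V E)"
proof (rule equivI)
  show "ray_equiv V E \<subseteq> rays V E \<times> rays V E" by (auto simp: ray_equiv_def)
  have never: "(\<forall>s. \<not> sides s r r') \<longleftrightarrow> (\<forall>k. same k r r')" for r r'
    unfolding same_def by (meson not_less_eq_eq order_refl)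
  show "refl_on (rays V E) (ray_equiv V E)"
    unfolding refl_on_def ray_equiv_iff never using same_refl by blast
  show "sym (ray_equiv V E)"
    unfolding sym_def ray_equiv_iff never using same_sym by blast
  show "trans (ray_equiv V E)"
    unfolding trans_def ray_equiv_iff never using same_trans by blast
qed

lemma vertex_end_iff:
  assumes "\<omega> \<in> vertex_ends V E" "r \<in> \<omega>"
  shows "r \<in> rays V E" "q \<in> \<omega> \<longleftrightarrow> (r, q) \<in> ray_equiv V E"
proof -
  obtain x where x: "\<omega> = ray_equiv V E `` {x}"
    using assms(1) by (auto simp: vertex_ends_def elim: quotientE)
  then have "(x, r) \<in> ray_equiv V E" using assms(2) by simp
  then have "\<omega> = ray_equiv V E `` {r}" using equiv_class_eq[OF equiv_ray_equiv] x by simp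
  then show "r \<in> rays V E" "q \<in> \<omega> \<longleftrightarrow> (r, q) \<in> ray_equiv V E" using assms(2) by (auto simp: ray_equiv_iff)
qed

lemma lives_in_iff:
  assumes \<omega>: "\<omega> \<in> vertex_ends V E" "r \<in> \<omega>" and fos: "finite_order_separation V E s"
  shows "lives_in \<omega> (fst s) \<longleftrightarrow> tail_in r (fst s)"
proof
  note r = vertex_end_iff[OF \<omega>]
  assume "lives_in \<omega> (fst s)"
  then obtain q where q: "q \<in> \<omega>" "range q \<subseteq> fst s" by (auto simp: lives_in_def)
  then have tl: "tail_in q (fst s)" by (simp add: tail_in_def range_subsetD)
  show "tail_in r (fst s)"
  proof (rule ccontr)
    assume "\<not> tail_in r (fst s)"
    then have "tail_in r (snd s)" using tail_cases_sep[OF r(1) fos] by blast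
    then have "sides (sep_reverse s) r q" using tl fos_reverse[OF fos] by (simp add: sides_def)
    then show False using r(2) q(1) ray_equiv_iff by blast
  qed
next
  note r = vertex_end_iff[OF \<omega>]
  assume "tail_in r (fst s)"
  then obtain n where n: "\<And>m. m \<ge> n \<Longrightarrow> r m \<in> fst s"
    by (auto simp: tail_in_def eventually_sequentially)
  define q where "q m = r (m + n)" for m
  have q: "q \<in> rays V E"
    using r(1) inj_compose[of r "\<lambda>m. m + n"] by (auto simp: rays_def q_def[abs_def] comp_def)
  have "\<not> sides t r q" for t
  proof
    assume t: "sides t r q"
    then have "tail_in r (snd t)"
      using eventually_sequentially_seg[of "\<lambda>m. r m \<in> snd t" n]
      by (simp add: sides_def tail_in_def q_def)
    then show False
      using tail_not_both[OF r(1), of "fst t" "snd t"] t by (simp add: sides_def)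
  qed
  then have "q \<in> \<omega>" using r q by (simp add: ray_equiv_iff)
  moreover have "range q \<subseteq> fst s" using n by (auto simp: q_def)
  ultimately show "lives_in \<omega> (fst s)" by (auto simp: lives_in_def)
qed

lemma distinguishes_iff:
  assumes "\<omega> \<in> vertex_ends V E" "r \<in> \<omega>" "\<omega>' \<in> vertex_ends V E" "r' \<in> \<omega>'"
  shows "distinguishes V E s \<omega> \<omega>' \<longleftrightarrow> sides s r r' \<or> sides s r' r"
proof (cases "finite_order_separation V E s")
  case True
  then show ?thesis
    using lives_in_iff[OF assms(1,2) True] lives_in_iff[OF assms(1,2) fos_reverse[OF True]]
      lives_in_iff[OF assms(3,4) True] lives_in_iff[OF assms(3,4) fos_reverse[OF True]]
    by (auto simp: distinguishes_def sides_def)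
next
  case False
  then show ?thesis by (simp add: distinguishes_def sides_def)
qed

lemma eff_distinguishes:
  assumes "\<omega> \<in> vertex_ends V E" "r \<in> \<omega>" "\<omega>' \<in> vertex_ends V E" "r' \<in> \<omega>'"
    and e: "eff s r r' \<or> eff s r' r"
  shows "distinguishes_efficiently V E s \<omega> \<omega>'"
proof -
  have "sep_order s \<le> sep_order t" if "sides t r r' \<or> sides t r' r" for t
    using that e eff_le[of s _ _ t] eff_le[of s _ _ "sep_reverse t"] sides_reverse[of t]
      sep_order_reverse[of t] by metis
  then show ?thesis
    using e eff_sides unfolding distinguishes_efficiently_def distinguishes_iff[OF assms(1-4)] by blast
qed

end

theorem corollary5p17:
  fixes V :: "'a set" and E :: "'a set set"
  assumes "simple_graph V E"
  shows "\<exists>N. (\<forall>s\<in>N. finite_order_separation V E s) \<and> nested_set N \<and>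
    (\<forall>\<omega>\<in>vertex_ends V E. \<forall>\<omega>'\<in>vertex_ends V E. \<omega> \<noteq> \<omega>' \<longrightarrow>
      (\<exists>s\<in>N. distinguishes_efficiently V E s \<omega> \<omega>'))"
proof -
  interpret graph V E using assms by unfold_locales
  obtain M where M: "\<forall>X\<in>M. \<forall>Y\<in>M. snest X Y"
    "\<forall>r\<in>rays V E. \<forall>r'\<in>rays V E. (\<exists>s. sides s r r') \<longrightarrow> (\<exists>s. eff s r r' \<and> separator s \<in> M)"
    using nested_separators by blast
  interpret nested_separators V E M
  proof
    show "snest X Y" if "X \<in> M" "Y \<in> M" for X Y using M(1) that by blast
    show "\<exists>t. eff t r r' \<and> separator t \<in> M"
      if "r \<in> rays V E" "r' \<in> rays V E" "sides s r r'" for r r' s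
      using M(2) that by metis
  qed
  obtain N where N: "\<forall>s\<in>N. finite_order_separation V E s" "nested_set N"
    and complete: "\<And>r r' s. r \<in> rays V E \<Longrightarrow> r' \<in> rays V E \<Longrightarrow> sides s r r' \<Longrightarrow>
      \<exists>t\<in>N. eff t r r' \<or> eff t r' r"
    using nested_separations by metis
  have "\<exists>s\<in>N. distinguishes_efficiently V E s \<omega> \<omega>'"
    if ends: "\<omega> \<in> vertex_ends V E" "\<omega>' \<in> vertex_ends V E" "\<omega> \<noteq> \<omega>'" for \<omega> \<omega>'
  proof -
    obtain r r' where r: "r \<in> \<omega>" "r' \<in> \<omega>'"
      using ends(1,2) in_quotient_imp_non_empty[OF equiv_ray_equiv] unfolding vertex_ends_def by blast
    have "(r, r') \<notin> ray_equiv V E"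
      using quotient_eqI[OF equiv_ray_equiv, of \<omega> \<omega>' r r'] ends r unfolding vertex_ends_def by blast
    then obtain s where "sides s r r'"
      using ray_equiv_iff vertex_end_iff(1)[OF ends(1) r(1)] vertex_end_iff(1)[OF ends(2) r(2)] by blast
    from complete[OF vertex_end_iff(1)[OF ends(1) r(1)] vertex_end_iff(1)[OF ends(2) r(2)] this]
    show ?thesis using eff_distinguishes[OF ends(1) r(1) ends(2) r(2)] by blast
  qed
  then show ?thesis using N by blast
qed

end
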